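(* Let $s\in\,]0,1[$ and let $q_s:\mathbb{R}_+\to\mathbb{C}$ be the function defined in the context. Then $$\int_0^\infty\tfrac1\pi\operatorname{sinc}(x-y)\,q_s(y)\,dy=s\,q_s(x)\qquad\text{for all }x>0 .$$ Hence $q_s$ is a spectral function, for the spectral value $s$, of the Wiener-Hopf operator $K$ on $L^2(\mathbb{R}_+)$ with kernel $\frac1\pi\operatorname{sinc}$.
   Context: $\mathbb{R}_+=\{x\in\mathbb{R}:x>0\}$. $\operatorname{sinc}(x)=\frac{\sin x}{x}$ for $x\ne0$, $\operatorname{sinc}(0)=1$. $K$ is the operator $(Kg)(x)=\int_0^\infty\frac1\pi\operatorname{sinc}(x-y)g(y)\,dy$ on $L^2(\mathbb{R}_+)$. A solution $u$ of the homogeneous equation $s\,u(x)-\int_0^\infty k(x-y)u(y)\,dy=0$ for $x>0$ is called a spectral function (generalized eigenfunction) for the spectral value (generalized eigenvalue) $s$ of the Wiener-Hopf operator with kernel $k$; it need not lie in $L^2(\mathbb{R}_+)$. Let $\ln$ be the principal branch of the logarithm (cut along the negative real axis). For $w\in\mathbb{C}\setminus[-1,1]$ (at points where the formula below is not directly defined, $Q_s$ is understood by holomorphic continuation) put $$Q_s(w)=\frac{w}{w^2-1}\exp\Big(-\tfrac12\ln\big(\tfrac{w^2}{w^2-1}\big)\Big)\exp\Big(\tfrac{i}{2\pi}\ln\big(\tfrac1s-1\big)\ln\big(\tfrac{w-1}{w+1}\big)\Big);$$ $Q_s$ is holomorphic on $\mathbb{C}\setminus[-1,1]$. For $x>0$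 and any $b>0$, $$q_s(x)=(2\pi)^{-1/2}\int_{-\infty+ib}^{\infty+ib}e^{-ixw}Q_s(w)\,dw:=(2\pi)^{-1/2}\lim_{A\to\infty}\int_{-A+ib}^{A+ib}e^{-ixw}Q_s(w)\,dw,$$ the limit existing and being independent of $b>0$. *)

theory Defs
  imports "HOL-Complex_Analysis.Complex_Analysis" "HOL-Probability.Sinc_Integral"
begin

text \<open>
  The function \<open>Q\<^sub>s\<close>. Both arguments of the principal logarithm depending on \<open>w\<close> avoid
  \<open>]-\<infinity>, 0]\<close> for every \<open>w\<close> outside the real segment \<open>[-1, 1]\<close>, so the formula applies verbatim
  on that domain and no continuation has to be taken.
\<close>
definition Q :: "real \<Rightarrow> complex \<Rightarrow> complex" where
  "Q s w = w / (w\<^sup>2 - 1) * exp (- (1/2) * Ln (w\<^sup>2 / (w\<^sup>2 - 1)))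
     * exp (\<i> / (2 * complex_of_real pi) * Ln (1 / complex_of_real s - 1) * Ln ((w - 1) / (w + 1)))"

text \<open>
  The value \<open>q\<^sub>s(x)\<close> is the common limit, over all heights \<open>b > 0\<close>, of the symmetrically truncated
  integrals along \<open>Im w = b\<close>. It is meaningful only for \<open>x > 0\<close>.
\<close>
definition q :: "real \<Rightarrow> real \<Rightarrow> complex" where
  "q s x = complex_of_real ((2 * pi) powr (- 1/2)) *
     (THE l. \<forall>b>0. ((\<lambda>A. contour_integral (linepath (Complex (- A) b) (Complex A b))
                            (\<lambda>w. exp (- \<i> * complex_of_real x * w) * Q s w)) \<longlongrightarrow> l) at_top)"

definition wiener_hopf :: "(real \<Rightarrow> complex) \<Rightarrow> (real \<Rightarrow> complex) \<Rightarrow> real \<Rightarrow> complex" where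
  "wiener_hopf k u x = (LBINT y:{0<..}. k (x - y) * u y)"

text \<open>
  \<open>u\<close> is not required to be square integrable. Integrability of \<open>y \<mapsto> k (x - y) * u y\<close> is demanded
  explicitly since the Lebesgue integral of a non-integrable function is \<open>0\<close> in the library.
\<close>
definition spectral_function :: "(real \<Rightarrow> complex) \<Rightarrow> complex \<Rightarrow> (real \<Rightarrow> complex) \<Rightarrow> bool" where
  "spectral_function k s u \<longleftrightarrow>
     (\<forall>x>0. set_integrable lborel {0<..} (\<lambda>y. k (x - y) * u y) \<and> s * u x - wiener_hopf k u x = 0)"

definition sinc_kernel :: "real \<Rightarrow> complex" where
  "sinc_kernel t = complex_of_real (1 / pi * sinc t)"

end

theory Submission
  imports Defs "HOL-Real_Asymp.Real_Asymp"
begin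

text \<open>
  Put \<open>l = ln (1/s - 1) / (2 \<pi>)\<close>, so that \<open>Q\<^sub>s(w) = (w - 1)\<^bsup>-1/2 + il\<^esup> (w + 1)\<^bsup>-1/2 - il\<^esup>\<close>. Up to the factor
  \<open>cosh(\<pi>l)/\<pi>\<close> this is the Cauchy transform of the jump of \<open>Q\<^sub>s\<close> across \<open>[-1, 1]\<close>; in the coordinate
  \<open>t = tanh v\<close> on the cut the jump becomes the density \<open>exp(-2ilv) / cosh v\<close>. Closing the contour in the lower
  half plane turns \<open>q\<^sub>s(x)\<close> into a multiple of \<open>h(x) = \<integral> exp(-ix tanh v) exp(-2ilv) / cosh v dv\<close>, which is
  \<open>O(x\<^bsup>-1/2\<^esup>)\<close> by an integration by parts.

  The operator \<open>K\<close> cuts \<open>h\<close> off to the half line, which turns the jump of \<open>Q\<^sub>s\<close> into its boundary value from above,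
  and then restricts the spectrum to \<open>[-1, 1]\<close>. On \<open>[-1, 1]\<close> the boundary value from above is exactly
  \<open>e\<^bsup>-\<pi>l\<^esup> / (2 cosh(\<pi>l)) = s\<close> times the jump, whence \<open>K h = s h\<close>. The boundary value is reached through the damping
  factor \<open>exp(-\<epsilon>y)\<close>, which makes all the interchanges of integrals absolutely convergent.
\<close>

subsection \<open>Integrals involving hyperbolic functions\<close>

lemma integral_FTC_real_line:
  fixes f F :: "real \<Rightarrow> 'a::euclidean_space"
  assumes "\<And>x. (F has_vector_derivative f x) (at x)" "\<And>x. isCont f x" "integrable lborel f"
    and "(F \<longlongrightarrow> a) at_bot" "(F \<longlongrightarrow> b) at_top"
  shows "integral\<^sup>L lborel f = b - a"
proof -
  have "(LBINT x=-\<infinity>..\<infinity>. f x) = b - a"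
    using assms by (intro interval_integral_FTC_integrable) (auto simp: ereal_tendsto_simps set_integrable_def)
  then show ?thesis
    by (simp add: interval_lebesgue_integral_def set_lebesgue_integral_def)
qed

lemma contour_integral_linepath_same_Im:
  assumes "a < b"
  shows "contour_integral (linepath (Complex a d) (Complex b d)) f = integral {a..b} (\<lambda>x. f (Complex x d))"
proof -
  have "contour_integral (linepath (Complex a d) (Complex b d)) f
      = of_real (b - a) * integral {0..1} (\<lambda>x. f (Complex (a + (b - a) * x) d))"
  proof -
    have "linepath (Complex a d) (Complex b d) x = Complex (a + (b - a) * x) d" for x
      by (simp add: linepath_def complex_eq_iff algebra_simps)
    moreover have "Complex b d - Complex a d = of_real (b - a)"
      by (simp add: complex_eq_iff)
    ultimately show ?thesis
      by (simp add: contour_integral_integral mult.commute)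
  qed
  also have "{0..1} = (\<lambda>x. x / (b - a)) ` {0..b - a}"
    using assms by simp
  also have "integral \<dots> (\<lambda>x. f (Complex (a + (b - a) * x) d))
      = integral {a-a..b-a} (\<lambda>x. f (Complex (x + a) d)) / of_real (b - a)"
    using assms by (subst integral_stretch_real) (auto simp: scaleR_conv_of_real add_ac)
  also have "\<dots> = integral {a..b} (\<lambda>x. f (Complex x d)) / of_real (b - a)"
    by (subst integral_shift_real_ivl) (rule refl)
  finally show ?thesis using assms by simp
qed

text \<open>With \<open>r = sqrt (1 + y)\<close> the integrand is the derivative of
  \<open>arctan (sinh v / r) / r\<close>, because
  \<open>r\<^sup>2 + (sinh v)\<^sup>2 = (cosh v)\<^sup>2 + y\<close>. The case \<open>y = 0\<close>
  yields integrability of \<open>1 / cosh\<close>, and general \<open>y\<close> is the source of the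
  inverse square root decay of the transform.\<close>

lemma
  fixes y :: real
  assumes "y \<ge> 0"
  shows integrable_cosh_over: "integrable lborel (\<lambda>v::real. cosh v / ((cosh v)\<^sup>2 + y))"
    and integral_cosh_over: "(LBINT v. cosh v / ((cosh v)\<^sup>2 + y)) = pi / sqrt (1 + y)"
proof -
  define r where "r = sqrt (1 + y)"
  have r: "r > 0" "r\<^sup>2 = 1 + y" using assms by (auto simp: r_def)
  let ?f = "\<lambda>v::real. cosh v / ((cosh v)\<^sup>2 + y)" and ?F = "\<lambda>v. arctan (sinh v / r) / r"
  have pos: "(cosh v)\<^sup>2 + y > 0" for v :: real
    using assms by (intro add_pos_nonneg) auto
  have D: "(?F has_real_derivative ?f v) (at v)" for v
  proof -
    have "(?F has_real_derivative inverse (1 + (sinh v / r)\<^sup>2) * (cosh v / r) / r) (at v)"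
      using r by (auto intro!: derivative_eq_intros)
    moreover have "inverse (1 + (sinh v / r)\<^sup>2) * (cosh v / r) / r = cosh v / (r\<^sup>2 + (sinh v)\<^sup>2)"
    proof -
      have "1 + (sinh v / r)\<^sup>2 = (r\<^sup>2 + (sinh v)\<^sup>2) / r\<^sup>2"
        using r(1) by (simp add: power_divide add_divide_distrib)
      then show ?thesis using r(1) by (simp add: power2_eq_square)
    qed
    moreover have "r\<^sup>2 + (sinh v)\<^sup>2 = (cosh v)\<^sup>2 + y"
      using r by (simp add: cosh_square_eq)
    ultimately show ?thesis by metis
  qed
  have C: "isCont ?f v" for v
    using pos[of v] by (intro continuous_intros) auto
  have sh: "filterlim (\<lambda>v. sinh v / r) at_top at_top" "filterlim (\<lambda>v. sinh v / r) at_bot at_bot"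
    using r(1) unfolding sinh_field_def by real_asymp+
  have T: "(?F \<longlongrightarrow> pi / 2 / r) at_top" "(?F \<longlongrightarrow> - (pi / 2) / r) at_bot"
    using r(1) by (intro tendsto_divide tendsto_const filterlim_compose[OF tendsto_arctan_at_top sh(1)]
          filterlim_compose[OF tendsto_arctan_at_bot sh(2)]; simp)+
  have "set_integrable lborel (einterval (-\<infinity>) \<infinity>) ?f" "(LBINT x=-\<infinity>..\<infinity>. ?f x) = pi / 2 / r - (- (pi / 2) / r)"
    using D C T pos by (intro interval_integral_FTC_nonneg[where F="?F"]; force simp: ereal_tendsto_simps less_imp_le)+
  then show "integrable lborel ?f" "(LBINT v. ?f v) = pi / sqrt (1 + y)"
    by (auto simp: set_integrable_def interval_lebesgue_integral_def set_lebesgue_integral_def r_def field_simps)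
qed

lemma integrable_sech: "integrable lborel (\<lambda>v::real. 1 / cosh v)"
  using integrable_cosh_over[of 0] by (simp add: power2_eq_square)

subsection \<open>The Fourier transform of the hyperbolic secant\<close>

text \<open>The density on the cut in the coordinate \<open>t = tanh v\<close>, with the Jacobian
  absorbed. The argument is complex so that the line of integration can be moved; the poles are the
  zeros of \<open>cosh\<close> on the imaginary axis.\<close>

definition osc_sech :: "real \<Rightarrow> complex \<Rightarrow> complex" where
  "osc_sech l v = exp (- 2 * \<i> * of_real l * v) / cosh v"

text \<open>Common source of three facts: dropping the cosine gives a lower bound uniform in the
  height, for the vertical sides of rectangles; factoring the cosine out gives one for horizontal
  lines; and the zeros of \<open>cosh\<close> are those of a sum of two squares.\<close>

lemma norm_cosh_square: "(norm (cosh z))\<^sup>2 = (sinh (Re z))\<^sup>2 + (cos (Im z))\<^sup>2"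
proof -
  have "Re (cosh z) = cosh (Re z) * cos (Im z)" "Im (cosh z) = sinh (Re z) * sin (Im z)"
    by (simp_all add: cosh_field_def sinh_field_def Re_exp Im_exp field_simps)
  moreover have "((sinh (Re z))\<^sup>2 + 1) * c\<^sup>2 + (sinh (Re z))\<^sup>2 * d\<^sup>2 = (sinh (Re z))\<^sup>2 + c\<^sup>2"
    if "d\<^sup>2 + c\<^sup>2 = 1" for c d :: real
    using that by algebra
  ultimately show ?thesis
    by (simp add: cmod_power2 power_mult_distrib cosh_square_eq)
qed

lemma norm_cosh_ge_sinh: "norm (cosh z) \<ge> \<bar>sinh (Re z)\<bar>"
  by (rule power2_le_imp_le) (auto simp: norm_cosh_square)

lemma norm_cosh_ge_cosh: "norm (cosh z) \<ge> \<bar>cos (Im z)\<bar> * cosh (Re z)"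
proof (rule power2_le_imp_le)
  have "(sinh (Re z))\<^sup>2 * (cos (Im z))\<^sup>2 \<le> (sinh (Re z))\<^sup>2 * 1"
    by (intro mult_left_mono) (auto simp: abs_square_le_1)
  then show "(\<bar>cos (Im z)\<bar> * cosh (Re z))\<^sup>2 \<le> (norm (cosh z))\<^sup>2"
    by (simp add: norm_cosh_square power_mult_distrib cosh_square_eq algebra_simps)
qed simp

lemma cosh_eq_0_iff: "cosh z = 0 \<longleftrightarrow> Re z = 0 \<and> cos (Im z) = 0"
proof -
  have "cosh z = 0 \<longleftrightarrow> (sinh (Re z))\<^sup>2 + (cos (Im z))\<^sup>2 = 0"
    by (simp flip: norm_cosh_square)
  then show ?thesis by (simp add: sum_power2_eq_zero_iff)
qed

lemma continuous_on_osc_sech: "(\<And>z. z \<in> A \<Longrightarrow> cosh z \<noteq> 0) \<Longrightarrow> continuous_on A (osc_sech l)"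
  unfolding osc_sech_def by (auto intro!: continuous_intros)

lemma continuous_on_osc_sech_horizontal:
  assumes "cos t \<noteq> 0"
  shows "continuous_on A (\<lambda>x. osc_sech l (Complex x t))"
  using assms unfolding osc_sech_def Complex_eq
  by (intro continuous_intros) (auto simp: cosh_eq_0_iff)

lemma norm_osc_sech_horizontal:
  assumes "cos t \<noteq> 0"
  shows "norm (osc_sech l (Complex x t)) \<le> exp (2 * l * t) / \<bar>cos t\<bar> * (1 / cosh x)"
proof -
  have "norm (osc_sech l (Complex x t)) = exp (2 * l * t) / norm (cosh (Complex x t))"
    by (simp add: osc_sech_def norm_divide)
  also have "\<dots> \<le> exp (2 * l * t) / (\<bar>cos t\<bar> * cosh x)"
    using norm_cosh_ge_cosh[of "Complex x t"] assms
    by (intro divide_left_mono mult_pos_pos) (auto simp: cosh_eq_0_iff)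
  finally show ?thesis by simp
qed

lemma integrable_osc_sech:
  assumes "cos t \<noteq> 0"
  shows "integrable lborel (\<lambda>x. osc_sech l (Complex x t))"
proof (rule Bochner_Integration.integrable_bound)
  show "integrable lborel (\<lambda>x. exp (2 * l * t) / \<bar>cos t\<bar> * (1 / cosh x))"
    by (intro integrable_mult_right integrable_sech)
  show "(\<lambda>x. osc_sech l (Complex x t)) \<in> borel_measurable lborel"
    using continuous_on_osc_sech_horizontal[OF assms] by (auto intro: borel_measurable_continuous_onI)
  show "AE x in lborel. norm (osc_sech l (Complex x t)) \<le> norm (exp (2 * l * t) / \<bar>cos t\<bar> * (1 / cosh x))"
    using norm_osc_sech_horizontal[OF assms] by (auto simp: abs_mult)
qed

lemma tendsto_integral_symmetric:
  fixes f :: "real \<Rightarrow> complex"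
  assumes f: "integrable lborel f"
  shows "((\<lambda>N. integral {-N..N} f) \<longlongrightarrow> integral\<^sup>L lborel f) at_top"
proof -
  have [measurable]: "f \<in> borel_measurable lborel"
    using f by auto
  have "((\<lambda>N. LBINT x. indicator {-N..N} x *\<^sub>R f x) \<longlongrightarrow> integral\<^sup>L lborel f) at_top"
  proof (rule integral_dominated_convergence_at_top[where w = "\<lambda>x. norm (f x)"])
    show "AE x in lborel. ((\<lambda>N. indicator {-N..N} x *\<^sub>R f x) \<longlongrightarrow> f x) at_top"
    proof (rule AE_I2)
      fix x
      have "eventually (\<lambda>N. indicator {-N..N} x *\<^sub>R f x = f x) at_top"
        using eventually_ge_at_top[of "\<bar>x\<bar>"] by eventually_elim (auto simp: indicator_def)
      then show "((\<lambda>N. indicator {-N..N} x *\<^sub>R f x) \<longlongrightarrow> f x) at_top"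
        by (rule tendsto_eventually)
    qed
  qed (use f in \<open>auto simp: indicator_def\<close>)
  moreover have "(LBINT x. indicator {-N..N} x *\<^sub>R f x) = integral {-N..N} f" for N
    using set_borel_integral_eq_integral(2)[of "{-N..N}" f] f
    by (simp add: set_lebesgue_integral_def set_integrable_def integrable_mult_indicator)
  ultimately show ?thesis by simp
qed

text \<open>The rectangle runs along the bottom to the right and along the top to the left, so the
  difference consists of the two vertical sides, each of length \<open>d - c\<close>. This serves
  both for shifting the line of \<open>osc_sech\<close> and for closing the contour in the
  definition of \<open>q\<close>.\<close>

lemma norm_contour_integral_rectpath_minus_horizontal_le:
  assumes ab: "a < b" and cd: "c < d"
    and cont: "continuous_on (path_image (rectpath (Complex a c) (Complex b d))) f"
    and bound: "\<And>t. t \<in> {c..d} \<Longrightarrow> norm (f (Complex a t)) \<le> B \<and> norm (f (Complex b t)) \<le> B"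
  shows "norm (contour_integral (rectpath (Complex a c) (Complex b d)) f
           - (contour_integral (linepath (Complex a c) (Complex b c)) f
              - contour_integral (linepath (Complex a d) (Complex b d)) f)) \<le> 2 * B * (d - c)"
proof -
  let ?a = "Complex a c" and ?b = "Complex b c" and ?c = "Complex b d" and ?d = "Complex a d"
  have image: "path_image (rectpath ?a ?c)
      = closed_segment ?a ?b \<union> closed_segment ?b ?c \<union> closed_segment ?c ?d \<union> closed_segment ?d ?a"
    by (simp add: rectpath_def Let_def path_image_join Un_assoc)
  have conts: "continuous_on (closed_segment ?a ?b) f" "continuous_on (closed_segment ?b ?c) f"
     "continuous_on (closed_segment ?c ?d) f" "continuous_on (closed_segment ?d ?a) f"
    using cont unfolding image by (auto elim!: continuous_on_subset)
  note ints = conts[THEN contour_integrable_continuous_linepath]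
  have "contour_integral (rectpath ?a ?c) f = contour_integral (linepath ?a ?b) f
      + contour_integral (linepath ?b ?c) f + contour_integral (linepath ?c ?d) f
      + contour_integral (linepath ?d ?a) f"
    using ints by (simp add: rectpath_def Let_def)
  moreover have "contour_integral (linepath ?c ?d) f = - contour_integral (linepath ?d ?c) f"
    using conts by (intro contour_integral_reverse_linepath)
  moreover have "norm (contour_integral (linepath ?b ?c) f) \<le> B * norm (?c - ?b)"
    "norm (contour_integral (linepath ?d ?a) f) \<le> B * norm (?a - ?d)"
  proof -
    have "B \<ge> 0" using bound[of c] cd by (auto intro: order_trans[OF norm_ge_zero])
    moreover have "norm (f z) \<le> B" if "z \<in> closed_segment ?b ?c \<union> closed_segment ?d ?a" for z
      using that cd bound[of "Im z"] by (cases z)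
        (auto simp: closed_segment_same_Re closed_segment_eq_real_ivl split: if_splits)
    ultimately show "norm (contour_integral (linepath ?b ?c) f) \<le> B * norm (?c - ?b)"
      "norm (contour_integral (linepath ?d ?a) f) \<le> B * norm (?a - ?d)"
      using ints by (auto intro!: contour_integral_bound_linepath)
  qed
  moreover have "norm (?c - ?b) = d - c" "norm (?a - ?d) = d - c"
    using cd by (simp_all add: cmod_def)
  ultimately show ?thesis
    using norm_triangle_ineq[of "contour_integral (linepath ?b ?c) f" "contour_integral (linepath ?d ?a) f"]
    by (simp add: algebra_simps)
qed

text \<open>At fixed height the vertical sides are \<open>O(1 / sinh N)\<close> and vanish in the
  limit. The residue contribution \<open>c\<close> stays a parameter because the shift is used both
  below and above the first pole.\<close>

lemma osc_sech_shift:
  assumes t: "t > 0" "cos t \<noteq> 0"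
    and rect: "\<And>N. N > 0 \<Longrightarrow> contour_integral (rectpath (Complex (-N) 0) (Complex N t)) (osc_sech l) = c"
  shows "(LBINT x. osc_sech l (Complex x 0)) - (LBINT x. osc_sech l (Complex x t)) = c"
proof -
  let ?I = "\<lambda>u N. integral {-N..N} (\<lambda>x. osc_sech l (Complex x u))"
  have "((\<lambda>N. ?I 0 N - ?I t N) \<longlongrightarrow> (LBINT x. osc_sech l (Complex x 0)) - (LBINT x. osc_sech l (Complex x t))) at_top"
    using t by (intro tendsto_diff tendsto_integral_symmetric integrable_osc_sech) auto
  moreover have "((\<lambda>N. ?I 0 N - ?I t N) \<longlongrightarrow> c) at_top"
  proof -
    have bound: "norm (c - (?I 0 N - ?I t N)) \<le> 2 * (exp (2 * \<bar>l\<bar> * t) / sinh N) * (t - 0)" if N: "N > 0" for N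
    proof -
      have "norm (contour_integral (rectpath (Complex (-N) 0) (Complex N t)) (osc_sech l)
           - (contour_integral (linepath (Complex (-N) 0) (Complex N 0)) (osc_sech l)
              - contour_integral (linepath (Complex (-N) t) (Complex N t)) (osc_sech l)))
           \<le> 2 * (exp (2 * \<bar>l\<bar> * t) / sinh N) * (t - 0)"
      proof (rule norm_contour_integral_rectpath_minus_horizontal_le)
        \<comment> \<open>A zero of \<open>cosh\<close> has real part 0, so on the boundary it could
          only lie at height 0 or \<open>t\<close>, where the cosine does not vanish.\<close>
        show "continuous_on (path_image (rectpath (Complex (-N) 0) (Complex N t))) (osc_sech l)"
          using t N by (intro continuous_on_osc_sech) (auto simp: path_image_rectpath cosh_eq_0_iff)
        fix r assume r: "r \<in> {0..t}"
        have *: "norm (osc_sech l z) \<le> exp (2 * \<bar>l\<bar> * t) / sinh N" if "Im z = r" "\<bar>Re z\<bar> = N" for z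
        proof -
          have "norm (osc_sech l z) = exp (2 * l * r) / norm (cosh z)"
            using that by (simp add: osc_sech_def norm_divide)
          also have "\<dots> \<le> exp (2 * \<bar>l\<bar> * t) / sinh N"
          proof (rule frac_le)
            have "l * r \<le> \<bar>l\<bar> * t" using r by (intro mult_mono) auto
            then show "exp (2 * l * r) \<le> exp (2 * \<bar>l\<bar> * t)" by simp
            have "\<bar>sinh (Re z)\<bar> = sinh N" using that N by (auto simp: abs_if split: if_splits)
            then show "sinh N \<le> norm (cosh z)" using norm_cosh_ge_sinh[of z] by simp
          qed (use N in auto)
          finally show ?thesis .
        qed
        show "norm (osc_sech l (Complex (-N) r)) \<le> exp (2 * \<bar>l\<bar> * t) / sinh N
            \<and> norm (osc_sech l (Complex N r)) \<le> exp (2 * \<bar>l\<bar> * t) / sinh N"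
          using N by (auto intro!: *)
      qed (use t N in auto)
      then show ?thesis
        using N by (simp add: rect contour_integral_linepath_same_Im)
    qed
    have "((\<lambda>N. 2 * (exp (2 * \<bar>l\<bar> * t) / sinh N) * (t - 0)) \<longlongrightarrow> 0) at_top"
      unfolding sinh_field_def by real_asymp
    then have "((\<lambda>N. c - (?I 0 N - ?I t N)) \<longlongrightarrow> 0) at_top"
      by (rule Lim_null_comparison[rotated])
         (use bound in \<open>auto intro: eventually_mono[OF eventually_gt_at_top[of 0]]\<close>)
    from tendsto_diff[OF tendsto_const[of c] this] show ?thesis by simp
  qed
  ultimately show ?thesis
    using tendsto_unique trivial_limit_at_top_linorder by blast
qed

text \<open>The only pole that can be enclosed is \<open>\<i> pi / 2\<close>, since
  \<open>t < 3 / 2 * pi\<close> stays below the next one. There \<open>sinh\<close> equals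
  \<open>\<i>\<close>, so the residue is \<open>exp (l * pi) / \<i>\<close>.\<close>

lemma contour_integral_rectpath_osc_sech:
  assumes N: "N > 0" and t: "0 < t" "t < 3 / 2 * pi" "t \<noteq> pi / 2"
  shows "contour_integral (rectpath (Complex (-N) 0) (Complex N t)) (osc_sech l)
           = (if t < pi / 2 then 0 else 2 * pi * exp (l * pi))"
proof -
  \<comment> \<open>An open convex strip bounded by the lines through the two neighbouring poles: it
    contains every rectangle considered and exactly one singularity.\<close>
  let ?S = "{z. - (pi / 2) < Im z} \<inter> {z. Im z < 3 / 2 * pi}" and ?p = "Complex 0 (pi / 2)"
  let ?R = "rectpath (Complex (-N) 0) (Complex N t)"
  have zero: "cos u = 0 \<longleftrightarrow> u = pi / 2" if "- (pi / 2) < u" "u < 3 / 2 * pi" for u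
  proof (cases "u < pi / 2")
    case True
    then show ?thesis using cos_gt_zero_pi[of u] that by auto
  next
    case False
    show ?thesis
    proof (cases "u = pi / 2")
      case True
      show ?thesis by (simp only: True cos_pi_half refl)
    next
      case False
      \<comment> \<open>Beyond \<open>pi / 2\<close> the number \<open>u - pi\<close> lies in the
        interval where the cosine is positive, and \<open>cos u = - cos (u - pi)\<close>.\<close>
      then show ?thesis using cos_gt_zero_pi[of "u - pi"] that \<open>\<not> u < pi / 2\<close> by auto
    qed
  qed
  have S: "open ?S" "convex ?S"
    by (intro open_Int convex_Int open_halfspace_Im_gt open_halfspace_Im_lt convex_halfspace_Im_gt convex_halfspace_Im_lt)+
  have cosh0: "z = ?p" if "cosh z = 0" "z \<in> ?S" for z
    using that(1)[unfolded cosh_eq_0_iff] that(2) zero[of "Im z"] by (auto intro: complex_eqI)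
  have image: "path_image ?R \<subseteq> ?S - {?p}"
    using N t pi_gt_zero by (auto simp: path_image_rectpath)
  have holo: "(cosh :: complex \<Rightarrow> complex) holomorphic_on A" for A
    unfolding cosh_field_def [abs_def] by (intro holomorphic_intros) auto
  have "contour_integral ?R (osc_sech l) = 2 * pi * \<i> * (\<Sum>p\<in>{?p}. winding_number ?R p * residue (osc_sech l) p)"
  proof (rule Residue_theorem)
    show "osc_sech l holomorphic_on ?S - {?p}"
      unfolding osc_sech_def using cosh0
      by (intro holomorphic_intros holo) auto
    show "\<forall>z. z \<notin> ?S \<longrightarrow> winding_number ?R z = 0"
      using N t pi_gt_zero by (auto intro!: winding_number_rectpath_outside simp: in_cbox_complex_iff)
  qed (use S image convex_connected in auto)
  also have "(\<Sum>p\<in>{?p}. winding_number ?R p * residue (osc_sech l) p) = winding_number ?R ?p * residue (osc_sech l) ?p"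
    by simp
  also have "residue (osc_sech l) ?p = exp (l * pi) / \<i>"
  proof -
    have sinh: "sinh ?p = \<i>"
      by (simp add: complex_eq_iff sinh_field_def Re_exp Im_exp)
    have "residue (\<lambda>v. exp (- 2 * \<i> * of_real l * v) / cosh v) ?p = exp (- 2 * \<i> * of_real l * ?p) / \<i>"
    proof (rule residue_simple_pole_deriv[where s = ?S])
      show "(cosh has_field_derivative \<i>) (at ?p)"
        using has_field_derivative_cosh[of "\<lambda>x. x" 1 ?p UNIV] sinh by simp
    qed (use S in \<open>auto intro!: holomorphic_intros holo convex_connected cosh_eq_0_iff[THEN iffD2]\<close>)
    moreover have "- 2 * \<i> * of_real l * ?p = of_real (l * pi)"
      by (simp add: complex_eq_iff)
    ultimately show ?thesis
      unfolding osc_sech_def by (simp only: exp_of_real)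
  qed
  also have "winding_number ?R ?p = (if t < pi / 2 then 0 else 1)"
    using N t by (auto intro!: winding_number_rectpath_outside winding_number_rectpath simp: in_cbox_complex_iff in_box_complex_iff)
  also have "complex_of_real (2 * pi) * \<i> * (w * (of_real E / \<i>)) = w * of_real (2 * pi * E)" for w E
    by (simp add: field_simps)
  finally show ?thesis
    by (cases "t < pi / 2") (simp_all only: if_True if_False mult_1 mult_zero_left of_real_0)
qed

text \<open>On the line of height \<open>pi\<close> the integrand is the real one times the constant
  \<open>- exp (2 * l * pi)\<close>. The rectangle of that height therefore gives a linear equation
  for the integral over the real line. Rectangles of height below \<open>pi / 2\<close> enclose no
  pole, so the value persists there.\<close>

lemma integral_osc_sech:
  assumes "0 \<le> t" "t < pi / 2"
  shows "(LBINT x. osc_sech l (Complex x t)) = pi / cosh (pi * l)"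
proof -
  let ?J = "\<lambda>t. LBINT x. osc_sech l (Complex x t)"
  have "?J 0 - ?J pi = 2 * pi * exp (l * pi)"
    using contour_integral_rectpath_osc_sech[of _ pi l] pi_gt_zero by (intro osc_sech_shift) auto
  moreover have "?J pi = - exp (2 * l * pi) * ?J 0"
  proof -
    have "osc_sech l (Complex x pi) = - exp (2 * l * pi) * osc_sech l (Complex x 0)" for x
    proof -
      have "exp (- 2 * \<i> * of_real l * Complex x pi) = exp (2 * l * pi) * exp (- 2 * \<i> * of_real l * Complex x 0)"
      proof -
        have "- 2 * \<i> * of_real l * Complex x pi = of_real (2 * l * pi) + - 2 * \<i> * of_real l * Complex x 0"
          by (simp add: complex_eq_iff)
        then show ?thesis by (simp only: exp_add exp_of_real)
      qed
      moreover have "cosh (Complex x pi) = - cosh (Complex x 0)"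
        by (simp add: complex_eq_iff cosh_field_def Re_exp Im_exp field_simps)
      ultimately show ?thesis by (simp add: osc_sech_def)
    qed
    then show ?thesis by simp
  qed
  ultimately have "of_real (1 + exp (2 * l * pi)) * ?J 0 = of_real (2 * pi * exp (l * pi))"
    by (simp add: algebra_simps)
  moreover have "1 + exp (2 * l * pi) = 2 * exp (l * pi) * cosh (pi * l)"
    by (simp add: cosh_field_def algebra_simps flip: exp_add)
  ultimately have "of_real (2 * exp (l * pi)) * (of_real (cosh (pi * l)) * ?J 0) = of_real (2 * exp (l * pi)) * of_real pi"
    by (simp only: of_real_mult mult_ac)
  then have "of_real (cosh (pi * l)) * ?J 0 = of_real pi"
    by (subst (asm) mult_cancel_left) auto
  then have J0: "?J 0 = pi / cosh (pi * l)"
    by (simp add: eq_divide_eq mult.commute)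
  moreover have "?J 0 - ?J t = 0" if "t > 0"
    using contour_integral_rectpath_osc_sech[of _ t l] assms that pi_gt_zero cos_gt_zero_pi[of t]
    by (intro osc_sech_shift) auto
  ultimately show ?thesis
    using assms(1) by (cases "t = 0") auto
qed

lemma cosh_complex_of_real: "cosh (complex_of_real v) = of_real (cosh v)"
  and sinh_complex_of_real: "sinh (complex_of_real v) = of_real (sinh v)"
  by (simp_all add: cosh_field_def sinh_field_def flip: exp_of_real)

text \<open>The Moebius map preserves the upper half plane, so the argument of the quotient lies
  strictly between 0 and \<open>pi\<close> and the principal logarithm is taken away from its
  cut.\<close>

lemma Im_moebius_pos:
  assumes "Im w > 0"
  shows "Im ((w - 1) / (w + 1)) > 0"
proof -
  have "(Re (w + 1))\<^sup>2 + (Im (w + 1))\<^sup>2 > 0"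
    using assms by (intro add_nonneg_pos) auto
  moreover have "Im ((w - 1) / (w + 1)) = 2 * Im w / ((Re (w + 1))\<^sup>2 + (Im (w + 1))\<^sup>2)"
    by (simp add: Im_divide algebra_simps)
  ultimately show ?thesis
    using assms by (simp only: divide_pos_pos mult_pos_pos zero_less_numeral)
qed

subsection \<open>The symbol as a Cauchy transform\<close>

text \<open>
  Since \<open>(w - 1) / (w + 1) = e\<^bsup>2u\<^esup>\<close>, the denominator \<open>w cosh v - sinh v\<close> equals \<open>(w + 1) e\<^bsup>u\<^esup> cosh (v + u)\<close>.
\<close>
lemma integral_osc_sech_over:
  assumes w: "Im w > 0"
  shows "(LBINT v. osc_sech l (of_real v) / (w - of_real (tanh v)))
           = of_real (pi / cosh (pi * l)) * (exp ((\<i> * of_real l - 1/2) * Ln ((w - 1) / (w + 1))) / (w + 1))"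
proof -
  define z where "z = (w - 1) / (w + 1)"
  define u where "u = Ln z / 2"
  have z: "Im z > 0" and "z \<noteq> 0" and w1: "w + 1 \<noteq> 0"
    using Im_moebius_pos[OF w] w unfolding z_def by (force simp: complex_eq_iff)+
  have wz: "(w + 1) * z = w - 1"
    using w1 by (simp add: z_def)
  have expu: "exp u * exp u = z"
    using \<open>z \<noteq> 0\<close> by (simp add: u_def flip: exp_add)
  \<comment> \<open>Halving an argument from \<open>]0, pi[\<close> lands below the first pole of
    \<open>osc_sech\<close>, which is exactly the range covered by
    \<open>integral_osc_sech\<close>.\<close>
  have Imu: "0 < Im u" "Im u < pi / 2"
    using Im_Ln_pos_lt_imp[OF z] by (auto simp: u_def)
  have point: "osc_sech l (of_real v) / (w - of_real (tanh v))
      = exp (2 * \<i> * of_real l * u) / ((w + 1) * exp u) * osc_sech l (Complex (Re u + 1 * v) (Im u))" for v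
  proof -
    have *: "Complex (Re u + 1 * v) (Im u) = of_real v + u"
      by (simp add: complex_eq_iff)
    have "(w + 1) * exp u * cosh (of_real v + u) = (w + 1) * (exp (of_real v) * (exp u * exp u) + exp (- of_real v)) / 2"
      by (simp add: cosh_field_def exp_add exp_minus exp_diff field_simps)
    also have "\<dots> = ((w - 1) * exp (of_real v) + (w + 1) * exp (- of_real v)) / 2"
      unfolding expu wz [symmetric] by (simp add: algebra_simps)
    also have "\<dots> = w * cosh (of_real v) - sinh (of_real v)"
      by (simp add: cosh_field_def sinh_field_def field_simps)
    also have "\<dots> = cosh (of_real v) * (w - of_real (tanh v))"
      by (simp add: tanh_def cosh_complex_of_real sinh_complex_of_real field_simps)
    finally have "cosh (of_real v) * (w - of_real (tanh v)) = (w + 1) * exp u * cosh (of_real v + u)" ..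
    moreover have "exp (- 2 * \<i> * of_real l * of_real v) = exp (2 * \<i> * of_real l * u) * exp (- 2 * \<i> * of_real l * (of_real v + u))"
      by (simp add: algebra_simps flip: exp_add)
    ultimately show ?thesis
      unfolding osc_sech_def * by (simp only: divide_divide_eq_left times_divide_times_eq)
  qed
  have "(LBINT v. osc_sech l (of_real v) / (w - of_real (tanh v)))
      = exp (2 * \<i> * of_real l * u) / ((w + 1) * exp u) * (LBINT v. osc_sech l (Complex (Re u + 1 * v) (Im u)))"
    unfolding point by (rule integral_mult_right_zero)
  \<comment> \<open>A horizontal translation by \<open>Re u\<close>; the factor \<open>1\<close> is
    written out to match the affine substitution rule.\<close>
  also have "(LBINT v. osc_sech l (Complex (Re u + 1 * v) (Im u))) = (LBINT v. osc_sech l (Complex v (Im u)))"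
    using lborel_integral_real_affine[of 1 "\<lambda>v. osc_sech l (Complex v (Im u))" "Re u"] by simp
  also have "\<dots> = of_real (pi / cosh (pi * l))"
    using Imu by (intro integral_osc_sech) auto
  also have "exp (2 * \<i> * of_real l * u) / ((w + 1) * exp u) = exp ((\<i> * of_real l - 1/2) * Ln z) / (w + 1)"
  proof -
    have "(\<i> * of_real l - 1/2) * Ln z = 2 * \<i> * of_real l * u - u"
      by (simp add: u_def algebra_simps)
    then show ?thesis by (simp add: exp_diff mult.commute)
  qed
  finally show ?thesis by (simp add: z_def mult.commute)
qed

text \<open>\<open>E\<close> and \<open>P\<close> are the principal square roots of
  \<open>(w - 1) / (w + 1)\<close> and \<open>w\<^sup>2 / (w\<^sup>2 - 1)\<close>. The squares of
  \<open>(w + 1) * E * P\<close> and \<open>w\<close> agree by algebra, so the only question is a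
  sign, which the real parts of the principal roots decide. The rest is rewriting with
  \<open>P = w / ((w + 1) * E)\<close>.\<close>

lemma Q_eq:
  assumes s: "0 < s" "s < 1" and w: "Im w > 0"
  shows "Q s w = exp ((\<i> * of_real (ln (1 / s - 1) / (2 * pi)) - 1/2) * Ln ((w - 1) / (w + 1))) / (w + 1)"
proof -
  define z where "z = (w - 1) / (w + 1)"
  define E where "E = exp (Ln z / 2)"
  define P where "P = exp (Ln (w\<^sup>2 / (w\<^sup>2 - 1)) / 2)"
  have z: "Im z > 0" and "z \<noteq> 0" and w0: "w \<noteq> 0" "w + 1 \<noteq> 0" "w - 1 \<noteq> 0"
    using Im_moebius_pos[OF w] w unfolding z_def by (force simp: complex_eq_iff)+
  have w2: "w\<^sup>2 - 1 = (w - 1) * (w + 1)" by (simp add: power2_eq_square algebra_simps)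
  have "w\<^sup>2 - 1 \<noteq> 0" using w0 by (simp add: w2)
  have E2: "E\<^sup>2 = z" and "E \<noteq> 0"
    using \<open>z \<noteq> 0\<close> by (auto simp: E_def power2_eq_square simp flip: exp_add)
  have P2: "P\<^sup>2 = w\<^sup>2 / (w\<^sup>2 - 1)" and "P \<noteq> 0"
    using w0 \<open>w\<^sup>2 - 1 \<noteq> 0\<close> by (auto simp: P_def power2_eq_square simp flip: exp_add)
  have ReE: "Re E > 0"
    using Im_Ln_pos_lt_imp[OF z] by (auto simp: E_def Re_exp intro!: mult_pos_pos cos_gt_zero_pi)
  \<comment> \<open>The principal argument lies in \<open>]-pi, pi]\<close>, so half of it has
    nonnegative cosine. The contradiction below gets its strictness from
    \<open>Re E > 0\<close>.\<close>
  have ReP: "Re P \<ge> 0"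
    using Im_Ln_le_pi[of "w\<^sup>2 / (w\<^sup>2 - 1)"] mpi_less_Im_Ln[of "w\<^sup>2 / (w\<^sup>2 - 1)"] w0 \<open>w\<^sup>2 - 1 \<noteq> 0\<close>
    by (auto simp: P_def Re_exp intro!: mult_nonneg_nonneg cos_ge_zero)
  have "((w + 1) * E * P)\<^sup>2 = w\<^sup>2"
    unfolding power_mult_distrib E2 P2 z_def w2 using w0 by (simp add: power2_eq_square)
  then have "(w + 1) * E * P = w \<or> (w + 1) * E * P = - w"
    by (simp add: power2_eq_iff)
  \<comment> \<open>The real part of \<open>(w + 1) E / w = 2 / (E + 1 / E)\<close> is positive, that of \<open>1 / P\<close> nonnegative.\<close>
  moreover have "(w + 1) * E * P \<noteq> - w"
  proof
    assume *: "(w + 1) * E * P = - w"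
    have "E + inverse E = 2 * w / ((w + 1) * E)"
    proof -
      have "(E + inverse E) * ((w + 1) * E) = E\<^sup>2 * (w + 1) + (w + 1)"
        using \<open>E \<noteq> 0\<close> by (simp add: algebra_simps power2_eq_square)
      also have "\<dots> = 2 * w"
        unfolding E2 z_def using w0 by simp
      finally show ?thesis
        using w0 \<open>E \<noteq> 0\<close> by (simp add: eq_divide_eq)
    qed
    also have "\<dots> = - 2 * P"
    proof -
      have "w = - ((w + 1) * E * P)" using * by simp
      also have "\<dots> = - P * ((w + 1) * E)" by (simp add: mult.commute)
      finally have *: "w = - P * ((w + 1) * E)" .
      have "(w + 1) * E \<noteq> 0"
        using w0 \<open>E \<noteq> 0\<close> by simp
      then have "w / ((w + 1) * E) = - P"
        by (rule nonzero_divide_eq_eq[THEN iffD2, OF _ *])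
      then show ?thesis by (metis times_divide_eq_right mult_minus_right mult_minus_left)
    qed
    finally have "Re (E + inverse E) \<le> 0" using ReP by simp
    moreover have "Re (inverse E) > 0"
      using ReE by (simp add: divide_pos_pos add_pos_nonneg)
    ultimately show False using ReE by simp
  qed
  ultimately have EP: "(w + 1) * E * P = w" by blast
  have ln: "Ln (1 / of_real s - 1) = of_real (ln (1 / s - 1))"
  proof -
    have "1 / of_real s - 1 = complex_of_real (1 / s - 1)" by simp
    moreover have "1 / s - 1 > 0" using s by simp
    ultimately show ?thesis by (simp only: Ln_of_real)
  qed
  have "Q s w = w / (w\<^sup>2 - 1) * inverse P * exp (\<i> * of_real (ln (1 / s - 1) / (2 * pi)) * Ln z)"
    unfolding Q_def ln by (simp add: P_def z_def exp_minus field_simps)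
  also have "w / (w\<^sup>2 - 1) * inverse P = P / w"
    using P2 w0 \<open>P \<noteq> 0\<close> \<open>w\<^sup>2 - 1 \<noteq> 0\<close> by (simp add: field_simps power2_eq_square)
  also have "P / w = inverse E / (w + 1)"
  proof -
    have "P / ((w + 1) * E * P) = inverse E / (w + 1)"
      using \<open>P \<noteq> 0\<close> by (simp add: inverse_eq_divide mult.commute)
    then show ?thesis unfolding EP .
  qed
  also have "inverse E = exp (- (1/2) * Ln z)"
    by (simp add: E_def exp_minus)
  finally show ?thesis
    by (simp add: z_def algebra_simps flip: exp_add)
qed

text \<open>Domination by a product of integrable functions gives absolute convergence on the
  product space. Every interchange of integrals below has this form, with \<open>1 / cosh\<close> of
  one variable as a factor.\<close>

lemma
  fixes F :: "real \<Rightarrow> real \<Rightarrow> complex" and f g :: "real \<Rightarrow> real"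
  assumes F [measurable]: "case_prod F \<in> borel_measurable (lborel \<Otimes>\<^sub>M lborel)"
    and f: "integrable lborel f" and g: "integrable lborel g"
    and bound: "\<And>r v. norm (F r v) \<le> f r * g v"
  shows Fubini_product_bound: "(LBINT r. LBINT v. F r v) = (LBINT v. LBINT r. F r v)"
    and integrable_product_bound: "integrable lborel (\<lambda>r. LBINT v. F r v)"
    and integrable_product_bound': "integrable lborel (\<lambda>v. LBINT r. F r v)"
proof -
  have sec: "integrable lborel (F r)" for r
    by (rule Bochner_Integration.integrable_bound[OF integrable_mult_right[OF g, of "f r"]])
       (use bound in \<open>auto intro: order_trans[OF _ abs_ge_self]\<close>)
  have int: "integrable (lborel \<Otimes>\<^sub>M lborel) (case_prod F)"
  proof (rule lborel_pair.Fubini_integrable)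
    show "integrable lborel (\<lambda>r. LBINT v. norm (case_prod F (r, v)))"
    proof (rule Bochner_Integration.integrable_bound[OF integrable_mult_left[OF f, of "integral\<^sup>L lborel g"]])
      show "AE r in lborel. norm (LBINT v. norm (case_prod F (r, v))) \<le> norm (f r * integral\<^sup>L lborel g)"
      proof (rule AE_I2)
        fix r
        have "(LBINT v. norm (F r v)) \<le> (LBINT v. f r * g v)"
          using bound sec g by (intro integral_mono) auto
        then show "norm (LBINT v. norm (case_prod F (r, v))) \<le> norm (f r * integral\<^sup>L lborel g)"
          by simp
      qed
    qed measurable
  qed (use sec in auto)
  show "(LBINT r. LBINT v. F r v) = (LBINT v. LBINT r. F r v)"
    using lborel_pair.Fubini_integral[OF int] by simp
  show "integrable lborel (\<lambda>r. LBINT v. F r v)"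
    using lborel_pair.integrable_fst'[OF int] by simp
  show "integrable lborel (\<lambda>v. LBINT r. F r v)"
    using lborel_pair.integrable_snd[OF int] by simp
qed

section \<open>Closing the contour: from the symbol to the transform of the density\<close>

lemma borel_measurable_tanh [measurable]: "(tanh :: real \<Rightarrow> real) \<in> borel_measurable borel"
  by (auto intro!: borel_measurable_continuous_onI continuous_intros)

lemma norm_osc_sech_real: "norm (osc_sech l (of_real v)) = 1 / cosh v"
  by (simp add: osc_sech_def norm_divide cosh_complex_of_real)

lemma borel_measurable_osc_sech [measurable]: "(\<lambda>v. osc_sech l (of_real v)) \<in> borel_measurable borel"
  unfolding osc_sech_def cosh_complex_of_real
  by (auto intro!: borel_measurable_continuous_onI continuous_intros)

lemma integrable_times_osc_sech:
  assumes [measurable]: "f \<in> borel_measurable borel" and "\<And>v. norm (f v) \<le> C"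
  shows "integrable lborel (\<lambda>v. f v * osc_sech l (of_real v))"
proof (rule Bochner_Integration.integrable_bound[OF integrable_mult_right[OF integrable_sech, of C]])
  have "C \<ge> 0" using assms(2)[of 0] by (auto intro: order_trans[OF norm_ge_zero])
  then show "AE v in lborel. norm (f v * osc_sech l (of_real v)) \<le> norm (C * (1 / cosh v))"
    using assms(2) by (auto simp: norm_mult norm_osc_sech_real divide_right_mono)
qed measurable

text \<open>
  The error is uniform in \<open>t\<close>. It comes from the lower part of a rectangle of depth \<open>sqrt A\<close>, which makes
  both the vertical sides and the bottom negligible.
\<close>
lemma norm_contour_integral_exp_over_le:
  fixes x b t A :: real
  assumes x: "x > 0" and b: "b > 0" and t: "\<bar>t\<bar> < 1" and A: "A > 1"
  shows "norm (contour_integral (linepath (Complex (-A) b) (Complex A b)) (\<lambda>w. exp (- \<i> * of_real x * w) / (w - of_real t))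
               + 2 * pi * \<i> * exp (- \<i> * of_real x * of_real t))
         \<le> 2 * (exp (x * b) / (A - 1)) * (b + sqrt A) + exp (- x * sqrt A) / sqrt A * (2 * A)"
proof -
  define S where "S = sqrt A"
  have S: "S > 0" using A by (simp add: S_def)
  let ?f = "\<lambda>w. exp (- \<i> * of_real x * w) / (w - complex_of_real t)"
  let ?R = "rectpath (Complex (-A) (-S)) (Complex A b)"
  have image: "path_image ?R \<subseteq> - {of_real t}"
    using A S b t by (auto simp: path_image_rectpath complex_eq_iff)
  have cont: "continuous_on X ?f" if "X \<subseteq> - {of_real t}" for X
    using that by (auto intro!: continuous_intros)
  have "(?f has_contour_integral 2 * pi * \<i> * winding_number ?R (of_real t) * exp (- \<i> * of_real x * of_real t)) ?R"
    using image by (intro Cauchy_integral_formula_convex_simple[where S = UNIV]) (auto intro!: holomorphic_intros)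
  moreover have "winding_number ?R (of_real t) = 1"
    using A S b t by (intro winding_number_rectpath) (auto simp: in_box_complex_iff)
  ultimately have R: "contour_integral ?R ?f = 2 * pi * \<i> * exp (- \<i> * of_real x * of_real t)"
    by (simp add: contour_integral_unique)
  let ?top = "contour_integral (linepath (Complex (-A) b) (Complex A b)) ?f"
  let ?bot = "contour_integral (linepath (Complex (-A) (-S)) (Complex A (-S))) ?f"
  have sides: "norm (contour_integral ?R ?f - (?bot - ?top)) \<le> 2 * (exp (x * b) / (A - 1)) * (b - (- S))"
  proof (rule norm_contour_integral_rectpath_minus_horizontal_le)
    fix r assume r: "r \<in> {-S..b}"
    have *: "norm (?f z) \<le> exp (x * b) / (A - 1)" if "Im z = r" "\<bar>Re z\<bar> = A" for z
    proof -
      have "norm (?f z) = exp (x * r) / norm (z - of_real t)"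
        using that by (simp add: norm_divide)
      also have "\<dots> \<le> exp (x * b) / (A - 1)"
      proof (rule frac_le)
        show "exp (x * r) \<le> exp (x * b)" using r x by simp
        have "A - 1 \<le> \<bar>Re (z - of_real t)\<bar>" using that t by auto
        then show "A - 1 \<le> norm (z - of_real t)" using abs_Re_le_cmod order_trans by blast
      qed (use A in auto)
      finally show ?thesis .
    qed
    show "norm (?f (Complex (- A) r)) \<le> exp (x * b) / (A - 1) \<and> norm (?f (Complex A r)) \<le> exp (x * b) / (A - 1)"
      using A by (intro conjI *) auto
  qed (use A S b cont[OF image] in auto)
  have bot: "norm ?bot \<le> exp (- x * S) / S * norm (Complex A (- S) - Complex (- A) (- S))"
  proof (rule contour_integral_bound_linepath)
    have seg: "Im z = - S" if "z \<in> closed_segment (Complex (- A) (- S)) (Complex A (- S))" for z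
      using that by (simp add: closed_segment_same_Im)
    show "?f contour_integrable_on linepath (Complex (- A) (- S)) (Complex A (- S))"
      using seg S by (intro contour_integrable_continuous_linepath cont) force
    show "norm (?f z) \<le> exp (- x * S) / S" if "z \<in> closed_segment (Complex (- A) (- S)) (Complex A (- S))" for z
    proof -
      have "S \<le> norm (z - of_real t)"
        using abs_Im_le_cmod[of "z - of_real t"] seg[OF that] S by simp
      then show ?thesis
        using seg[OF that] S by (auto simp: norm_divide intro!: divide_left_mono mult_pos_pos)
    qed
  qed (use S in auto)
  have width: "norm (Complex A (- S) - Complex (- A) (- S)) = 2 * A"
  proof -
    have "Complex A (- S) - Complex (- A) (- S) = of_real (2 * A)" by (simp add: complex_eq_iff)
    then show ?thesis using A by (simp only: norm_of_real)
  qed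
  \<comment> \<open>Up to the vertical sides the rectangle equals \<open>?bot - ?top\<close>. Hence
    \<open>?top\<close> is close to minus the residue value, and the error is that of the sides plus
    the bottom integral itself.\<close>
  have "norm (?top + contour_integral ?R ?f) = norm ((contour_integral ?R ?f - (?bot - ?top)) + ?bot)"
  proof -
    have "p + q = (q - (r - p)) + r" for p q r :: complex by simp
    then show ?thesis by (rule arg_cong)
  qed
  also have "\<dots> \<le> 2 * (exp (x * b) / (A - 1)) * (b + S) + exp (- x * S) / S * (2 * A)"
    using norm_add_rule_thm[OF sides bot] unfolding width diff_minus_eq_add .
  finally have "norm (?top + contour_integral ?R ?f) \<le> 2 * (exp (x * b) / (A - 1)) * (b + S) + exp (- x * S) / S * (2 * A)" .
  then show ?thesis unfolding R unfolding S_def .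
qed

text \<open>The function \<open>h\<close> of the overview. In the variable \<open>t = tanh v\<close>
  it is the Fourier integral over \<open>[-1, 1]\<close> of \<open>(1 - t)\<close> to the power
  \<open>-1/2 + \<i> l\<close> times \<open>(1 + t)\<close> to the power
  \<open>-1/2 - \<i> l\<close>, that is, a multiple of \<open>exp (\<i> x)\<close> times Kummer's
  confluent hypergeometric function with parameters \<open>1/2 - \<i> l\<close> and 1 at
  \<open>-2 \<i> x\<close>.\<close>

definition osc_transform :: "real \<Rightarrow> real \<Rightarrow> complex" where
  "osc_transform l x = (LBINT v. exp (- \<i> * of_real x * of_real (tanh v)) * osc_sech l (of_real v))"

lemma abs_tanh_less_1: "\<bar>tanh (v::real)\<bar> < 1"
  using tanh_real_lt_1[of v] tanh_real_gt_neg1[of v] by auto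

text \<open>On the line of height \<open>b\<close> the symbol is replaced by its Cauchy transform,
  with \<open>cosh (pi * l) / pi\<close> undoing the factor found there. For finite \<open>A\<close>
  Fubini applies and leaves the contour integral of a function with a single simple pole. The
  integrability claim later permits adding the residue term under the integral sign.\<close>

lemma
  assumes s: "0 < s" "s < 1" and b: "b > 0" and A: "A > 0"
  defines "l \<equiv> ln (1 / s - 1) / (2 * pi)"
  shows contour_integral_Q: "contour_integral (linepath (Complex (-A) b) (Complex A b)) (\<lambda>w. exp (- \<i> * of_real x * w) * Q s w)
       = of_real (cosh (pi * l) / pi) * (LBINT v. osc_sech l (of_real v) *
           contour_integral (linepath (Complex (-A) b) (Complex A b)) (\<lambda>w. exp (- \<i> * of_real x * w) / (w - of_real (tanh v))))" (is "_ = _ * (LBINT v. ?g v)")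
    and integrable_osc_sech_contour: "integrable lborel (\<lambda>v. osc_sech l (of_real v) *
           contour_integral (linepath (Complex (-A) b) (Complex A b)) (\<lambda>w. exp (- \<i> * of_real x * w) / (w - of_real (tanh v))))"
proof -
  define c where "c = complex_of_real (cosh (pi * l) / pi)"
  let ?e = "\<lambda>r. exp (- \<i> * of_real x * (of_real r + \<i> * of_real b))"
  \<comment> \<open>The indicator turns the truncated integral into one over the whole line, as the
    Fubini lemma expects.\<close>
  let ?F = "\<lambda>r v. indicator {-A..A} r *\<^sub>R (?e r * (osc_sech l (of_real v) / (of_real r + \<i> * of_real b - of_real (tanh v))))"
  have Cx: "Complex r b = of_real r + \<i> * of_real b" for r
    by (simp add: Complex_eq)
  \<comment> \<open>The line of integration stays at distance \<open>b\<close> from the cut, which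
    bounds the Cauchy kernel by \<open>1 / b\<close> uniformly in \<open>v\<close>.\<close>
  have ge: "b \<le> norm (of_real r + \<i> * of_real b - of_real (tanh v))" for r v
    using abs_Im_le_cmod[of "of_real r + \<i> * of_real b - of_real (tanh v)"] b by simp
  have nz: "of_real r + \<i> * of_real b - of_real (tanh v) \<noteq> 0" for r v
    using ge[of r v] b by (metis norm_zero not_less)
  have bound: "norm (?F r v) \<le> (exp (x * b) / b * indicator {-A..A} r) * (1 / cosh v)" for r v
  proof -
    have "norm (?e r * (osc_sech l (of_real v) / (of_real r + \<i> * of_real b - of_real (tanh v))))
        = exp (x * b) * (1 / cosh v) / norm (of_real r + \<i> * of_real b - of_real (tanh v))"
      by (simp add: norm_mult norm_divide norm_osc_sech_real)
    also have "\<dots> \<le> exp (x * b) * (1 / cosh v) / b"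
      using ge[of r v] b by (intro divide_left_mono) (auto intro!: mult_pos_pos)
    finally show ?thesis by (auto simp: indicator_def mult.commute)
  qed
  have meas: "case_prod ?F \<in> borel_measurable (lborel \<Otimes>\<^sub>M lborel)"
    by measurable
  have int: "integrable lborel (\<lambda>r. exp (x * b) / b * indicator {-A..A} r)"
    by (intro integrable_mult_right integrable_real_indicator) (auto simp: emeasure_lborel_Icc_eq)
  note Fub = meas int integrable_sech bound
  have inner: "(LBINT r. ?F r v) = ?g v" for v
  proof -
    have "continuous_on {-A..A} (\<lambda>r. ?e r / (of_real r + \<i> * of_real b - of_real (tanh v)))"
      using nz by (intro continuous_intros) blast
    then have "set_integrable lborel {-A..A} (\<lambda>r. ?e r / (of_real r + \<i> * of_real b - of_real (tanh v)))"
      by (rule borel_integrable_atLeastAtMost')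
    from set_borel_integral_eq_integral(2)[OF this]
    have top: "(LBINT r. indicator {-A..A} r *\<^sub>R (?e r / (of_real r + \<i> * of_real b - of_real (tanh v))))
       = contour_integral (linepath (Complex (-A) b) (Complex A b)) (\<lambda>w. exp (- \<i> * of_real x * w) / (w - of_real (tanh v)))"
      using A by (subst contour_integral_linepath_same_Im) (auto simp: set_lebesgue_integral_def Cx)
    have split: "?F r v = osc_sech l (of_real v) * (indicator {-A..A} r *\<^sub>R (?e r / (of_real r + \<i> * of_real b - of_real (tanh v))))" for r
      by (simp only: mult_scaleR_right times_divide_eq_right mult.commute)
    show ?thesis
      unfolding split integral_mult_right_zero top ..
  qed
  show "integrable lborel ?g"
    using integrable_product_bound'[OF Fub] unfolding inner .
  have "contour_integral (linepath (Complex (-A) b) (Complex A b)) (\<lambda>w. exp (- \<i> * of_real x * w) * Q s w)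
      = integral {-A..A} (\<lambda>r. exp (- \<i> * of_real x * Complex r b) * Q s (Complex r b))"
    using A by (intro contour_integral_linepath_same_Im) auto
  also have "\<dots> = integral {-A..A} (\<lambda>r. c * (LBINT v. ?e r * (osc_sech l (of_real v) / (of_real r + \<i> * of_real b - of_real (tanh v)))))"
  proof (rule integral_cong)
    fix r
    have "Q s (Complex r b) = c * (LBINT v. osc_sech l (of_real v) / (Complex r b - of_real (tanh v)))"
      using s b by (simp add: Q_eq integral_osc_sech_over c_def flip: l_def)
    then show "exp (- \<i> * of_real x * Complex r b) * Q s (Complex r b)
        = c * (LBINT v. ?e r * (osc_sech l (of_real v) / (of_real r + \<i> * of_real b - of_real (tanh v))))"
      unfolding Cx integral_mult_right_zero by (simp only: mult_ac)
  qed
  also have "\<dots> = c * (LBINT r. LBINT v. ?F r v)"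
  proof -
    have "(LBINT v. ?F r v) = indicator {-A..A} r *\<^sub>R (LBINT v. ?e r * (osc_sech l (of_real v) / (of_real r + \<i> * of_real b - of_real (tanh v))))" for r
      by (rule integral_scaleR_right)
    with integrable_product_bound[OF Fub]
    show ?thesis
      using set_borel_integral_eq_integral(2)[of "{-A..A}" "\<lambda>r. LBINT v. ?e r * (osc_sech l (of_real v) / (of_real r + \<i> * of_real b - of_real (tanh v)))"]
      by (simp add: set_lebesgue_integral_def set_integrable_def)
  qed
  also have "(LBINT r. LBINT v. ?F r v) = (LBINT v. ?g v)"
    unfolding inner [symmetric] by (rule Fubini_product_bound[OF Fub])
  finally show "contour_integral (linepath (Complex (-A) b) (Complex A b)) (\<lambda>w. exp (- \<i> * of_real x * w) * Q s w)
      = of_real (cosh (pi * l) / pi) * (LBINT v. ?g v)" by (simp only: c_def)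
qed

text \<open>Each inner contour integral tends to \<open>- 2 * pi * \<i>\<close> times the
  exponential at the pole, with an error independent of the pole. The limit therefore passes through
  the integral over \<open>v\<close>, and its value does not depend on \<open>b\<close>, so the
  definite description in \<open>q\<close> denotes it.\<close>

lemma q_eq_osc_transform:
  assumes s: "0 < s" "s < 1" and x: "x > 0"
  defines "l \<equiv> ln (1 / s - 1) / (2 * pi)"
  shows "q s x = of_real ((2 * pi) powr (- 1/2)) * (- 2 * \<i> * of_real (cosh (pi * l)) * osc_transform l x)"
proof -
  let ?L = "- 2 * \<i> * of_real (cosh (pi * l)) * osc_transform l x"
  let ?C = "\<lambda>b A. contour_integral (linepath (Complex (- A) b) (Complex A b)) (\<lambda>w. exp (- \<i> * of_real x * w) * Q s w)"
  have lim: "(?C b \<longlongrightarrow> ?L) at_top" if b: "b > 0" for b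
  proof -
    define err where "err = (\<lambda>A. 2 * (exp (x * b) / (A - 1)) * (b + sqrt A) + exp (- x * sqrt A) / sqrt A * (2 * A))"
    define k where "k = cosh (pi * l) / pi"
    let ?I = "\<lambda>A t. contour_integral (linepath (Complex (-A) b) (Complex A b)) (\<lambda>w. exp (- \<i> * of_real x * w) / (w - of_real t))"
    have err: "(err \<longlongrightarrow> 0) at_top"
      unfolding err_def using x b by real_asymp
    \<comment> \<open>Minus the limit of \<open>?I A (tanh v)\<close>, so that
      \<open>?I A (tanh v) + ?P v\<close> is the quantity bounded by \<open>err A\<close>.\<close>
    let ?P = "\<lambda>v. 2 * pi * \<i> * exp (- \<i> * of_real x * of_real (tanh v))"
    have intP: "integrable lborel (\<lambda>v. osc_sech l (of_real v) * ?P v)"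
      using integrable_times_osc_sech[of ?P "2 * pi" l] by (simp add: norm_mult mult.commute)
    have L: "?L = - of_real k * (LBINT v. osc_sech l (of_real v) * ?P v)"
    proof -
      have "(LBINT v. osc_sech l (of_real v) * ?P v) = (LBINT v. 2 * pi * \<i> * (exp (- \<i> * of_real x * of_real (tanh v)) * osc_sech l (of_real v)))"
        by (simp only: mult_ac)
      then show ?thesis
        by (simp add: k_def osc_transform_def)
    qed
    have bound: "norm (?C b A - ?L) \<le> err A * (\<bar>k\<bar> * (LBINT v. 1 / cosh v))" if A: "A > 1" for A
    proof -
      have intI: "integrable lborel (\<lambda>v. osc_sech l (of_real v) * ?I A (tanh v))"
        unfolding l_def using s b A by (intro integrable_osc_sech_contour) auto
      have "?C b A = of_real k * (LBINT v. osc_sech l (of_real v) * ?I A (tanh v))"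
        unfolding k_def l_def using s b A by (intro contour_integral_Q) auto
      then have "?C b A - ?L = of_real k * ((LBINT v. osc_sech l (of_real v) * ?I A (tanh v)) + (LBINT v. osc_sech l (of_real v) * ?P v))"
        unfolding L by (simp only: distrib_left mult_minus_left diff_minus_eq_add)
      also have "\<dots> = of_real k * (LBINT v. osc_sech l (of_real v) * (?I A (tanh v) + ?P v))"
        unfolding distrib_left by (simp only: Bochner_Integration.integral_add[OF intI intP] distrib_left)
      finally have "norm (?C b A - ?L) = \<bar>k\<bar> * norm (LBINT v. osc_sech l (of_real v) * (?I A (tanh v) + ?P v))"
        by (simp only: norm_mult norm_of_real)
      also have "\<dots> \<le> \<bar>k\<bar> * (LBINT v. err A * (1 / cosh v))"
      proof (intro mult_left_mono order_trans[OF integral_norm_bound] integral_mono)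
        show "integrable lborel (\<lambda>v. norm (osc_sech l (of_real v) * (?I A (tanh v) + ?P v)))"
          unfolding distrib_left by (intro integrable_norm Bochner_Integration.integrable_add intI intP)
        show "integrable lborel (\<lambda>v. err A * (1 / cosh v))"
          by (intro integrable_mult_right integrable_sech)
        fix v
        have "norm (?I A (tanh v) + ?P v) \<le> err A"
          unfolding err_def using x b A abs_tanh_less_1 by (intro norm_contour_integral_exp_over_le)
        then have "norm (?I A (tanh v) + ?P v) * (1 / cosh v) \<le> err A * (1 / cosh v)"
          by (rule mult_right_mono) simp
        then show "norm (osc_sech l (of_real v) * (?I A (tanh v) + ?P v)) \<le> err A * (1 / cosh v)"
          unfolding norm_mult norm_osc_sech_real by (simp only: mult.commute)
      qed (rule abs_ge_zero)
      also have "\<dots> = err A * (\<bar>k\<bar> * (LBINT v. 1 / cosh v))"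
        unfolding integral_mult_right_zero by (rule mult.left_commute)
      finally show ?thesis .
    qed
    have "((\<lambda>A. err A * (\<bar>k\<bar> * (LBINT v. 1 / cosh v))) \<longlongrightarrow> 0) at_top"
      using tendsto_mult_right[OF err] by simp
    then have "((\<lambda>A. ?C b A - ?L) \<longlongrightarrow> 0) at_top"
      by (rule Lim_null_comparison[rotated])
         (use bound in \<open>auto intro: eventually_mono[OF eventually_gt_at_top[of 1]]\<close>)
    then show ?thesis by (rule Lim_null[THEN iffD2])
  qed
  \<comment> \<open>Existence uses all heights at once; for uniqueness the single height
    \<open>b = 1\<close> suffices.\<close>
  have "(THE l. \<forall>b>0. (?C b \<longlongrightarrow> l) at_top) = ?L"
  proof (rule the_equality)
    show "\<forall>b>0. (?C b \<longlongrightarrow> ?L) at_top" using lim by blast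
    fix l' assume "\<forall>b>0. (?C b \<longlongrightarrow> l') at_top"
    then have "(?C 1 \<longlongrightarrow> l') at_top" by simp
    with lim[of 1] show "l' = ?L"
      by (intro tendsto_unique[OF trivial_limit_at_top_linorder]) simp_all
  qed
  then show ?thesis unfolding q_def by simp
qed

subsection \<open>Decay of the transform\<close>

lemma one_minus_tanh_square:
  fixes x :: "'a::{banach, real_normed_field}"
  assumes "cosh x \<noteq> 0"
  shows "1 - (tanh x)\<^sup>2 = 1 / (cosh x)\<^sup>2"
  using assms by (simp add: tanh_def power_divide diff_divide_eq_iff hyperbolic_pythagoras)

text \<open>After a weighted integration by parts every remaining term is bounded by a multiple of
  \<open>k\<close>: once for \<open>?G\<close> and \<open>2 * \<bar>l\<bar> + 1\<close> times for
  \<open>?G'\<close>. Since \<open>k\<close> integrates to \<open>pi / sqrt (1 + y)\<close>, the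
  constants add up to the bound. This decay makes the product with sinc absolutely
  integrable.\<close>

lemma norm_osc_transform_le:
  assumes y: "y \<ge> 0"
  shows "norm (osc_transform l y) \<le> (2 + 2 * \<bar>l\<bar>) * pi / sqrt (1 + y)"
proof -
  define e where "e = (\<lambda>v. exp (- \<i> * of_real y * of_real (tanh v)))"
  define p where "p = (\<lambda>v::real. exp (- 2 * \<i> * of_real l * of_real v))"
  define k where "k = (\<lambda>v::real. cosh v / ((cosh v)\<^sup>2 + y))"
  define k' where "k' = (\<lambda>v::real. sinh v * (y - (cosh v)\<^sup>2) / ((cosh v)\<^sup>2 + y)\<^sup>2)"
  let ?G = "\<lambda>v. p v * of_real (k v)"
  let ?G' = "\<lambda>v. p v * (- 2 * \<i> * of_real l * of_real (k v) + of_real (k' v))"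
  \<comment> \<open>The derivative of \<open>e v * ?G v\<close>; the first summand comes from the
    phase, whose speed is \<open>y / (cosh v)\<^sup>2\<close>.\<close>
  let ?E' = "\<lambda>v. - \<i> * of_real (y / (cosh v)\<^sup>2) * e v * ?G v + e v * ?G' v"
  have pos: "(cosh v)\<^sup>2 + y > 0" for v :: real
    using y by (intro add_pos_nonneg) auto
  have k0: "k v \<ge> 0" for v using pos[of v] by (simp add: k_def)
  have ne: "norm (e v) = 1" "norm (p v) = 1" for v
    by (simp_all add: e_def p_def)
  \<comment> \<open>Differentiating the weight costs nothing, so the derivative term inherits the
    integral of \<open>k\<close>.\<close>
  have k'_le: "\<bar>k' v\<bar> \<le> k v" for v
  proof -
    have "\<bar>k' v\<bar> = \<bar>sinh v\<bar> * \<bar>y - (cosh v)\<^sup>2\<bar> / ((cosh v)\<^sup>2 + y)\<^sup>2"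
      by (simp add: k'_def abs_mult)
    also have "\<dots> \<le> cosh v * ((cosh v)\<^sup>2 + y) / ((cosh v)\<^sup>2 + y)\<^sup>2"
    proof (intro divide_right_mono mult_mono)
      show "\<bar>sinh v\<bar> \<le> cosh v"
        by (rule power2_le_imp_le) (simp_all add: cosh_square_eq)
      show "\<bar>y - (cosh v)\<^sup>2\<bar> \<le> (cosh v)\<^sup>2 + y"
        using y zero_le_power2[of "cosh v"] by linarith
    qed auto
    also have "\<dots> = k v"
      using pos[of v] by (simp add: k_def power2_eq_square)
    finally show ?thesis .
  qed
  have cont: "continuous_on UNIV e" "continuous_on UNIV p" "continuous_on UNIV k" "continuous_on UNIV k'"
    unfolding e_def p_def k_def k'_def using pos less_imp_neq[OF pos] by (auto intro!: continuous_intros)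
  have [measurable]: "e \<in> borel_measurable borel" "p \<in> borel_measurable borel"
     "k \<in> borel_measurable borel" "k' \<in> borel_measurable borel"
    using cont by (auto intro: borel_measurable_continuous_onI)
  have k: "integrable lborel k" "integral\<^sup>L lborel k = pi / sqrt (1 + y)"
    using integrable_cosh_over[OF y] integral_cosh_over[OF y] by (simp_all add: k_def)
  have G: "integrable lborel (\<lambda>v. e v * ?G v)"
    by (rule Bochner_Integration.integrable_bound[OF k(1)]) (use k0 in \<open>auto simp: norm_mult ne\<close>)
  have G'_le: "norm (e v * ?G' v) \<le> (2 * \<bar>l\<bar> + 1) * k v" for v
  proof -
    have "norm (e v * ?G' v) = norm (- 2 * \<i> * of_real l * of_real (k v) + of_real (k' v))"
      by (simp add: norm_mult ne)
    also have "\<dots> \<le> norm (- 2 * \<i> * of_real l * of_real (k v)) + norm (complex_of_real (k' v))"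
      by (rule norm_triangle_ineq)
    also have "\<dots> = 2 * \<bar>l\<bar> * k v + \<bar>k' v\<bar>"
      using k0 by (simp add: norm_mult)
    also have "\<dots> \<le> (2 * \<bar>l\<bar> + 1) * k v"
      using k'_le[of v] by (simp add: algebra_simps)
    finally show ?thesis .
  qed
  have G': "integrable lborel (\<lambda>v. e v * ?G' v)"
    by (rule Bochner_Integration.integrable_bound[OF integrable_mult_right[OF k(1), of "2 * \<bar>l\<bar> + 1"]])
       (use G'_le in \<open>auto intro!: order_trans[OF _ abs_ge_self]\<close>)
  \<comment> \<open>The weight \<open>(cosh v)\<^sup>2 / ((cosh v)\<^sup>2 + y)\<close> interpolates between integrating by parts where the phase
    \<open>y tanh v\<close> moves fast and estimating trivially in the tails.\<close>
  have split: "e v * osc_sech l (of_real v) = e v * ?G v + - \<i> * (e v * ?G' v) + \<i> * ?E' v" for v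
  proof -
    have "k v * (1 + y / (cosh v)\<^sup>2) = 1 / cosh v"
    proof -
      have "1 + y / (cosh v)\<^sup>2 = ((cosh v)\<^sup>2 + y) / (cosh v)\<^sup>2"
        by (simp add: add_divide_distrib)
      then show ?thesis using pos[of v] by (simp add: k_def power2_eq_square)
    qed
    then have "osc_sech l (of_real v) = p v * of_real (k v * (1 + y / (cosh v)\<^sup>2))"
      by (simp add: osc_sech_def p_def cosh_complex_of_real)
    then have osc: "osc_sech l (of_real v) = p v * (of_real (k v) * (1 + of_real (y / (cosh v)\<^sup>2)))"
      by (simp only: of_real_mult of_real_add of_real_1)
    have "a * (b * (c * (1 + d))) = a * (b * c) + - \<i> * (a * (b * g)) + \<i> * (- \<i> * d * a * (b * c) + a * (b * g))"
      for a b c d g :: complex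
      by (simp add: algebra_simps)
    then show ?thesis unfolding osc .
  qed
  have int: "integrable lborel (\<lambda>v. e v * osc_sech l (of_real v))"
    by (rule integrable_times_osc_sech[where C = 1]) (auto simp: ne)
  \<comment> \<open>Solving \<open>split\<close> for \<open>?E'\<close> yields its integrability
    from that of the other three terms, without a separate estimate.\<close>
  have E'eq: "?E' = (\<lambda>v. - \<i> * (e v * osc_sech l (of_real v) - e v * ?G v + \<i> * (e v * ?G' v)))"
  proof
    have "x = - \<i> * (a + - \<i> * b + \<i> * x - a + \<i> * b)" for a b x :: complex
      by (simp add: algebra_simps)
    then show "?E' v = - \<i> * (e v * osc_sech l (of_real v) - e v * ?G v + \<i> * (e v * ?G' v))" for v
      unfolding split .
  qed
  have E': "integrable lborel ?E'"
    unfolding E'eq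
    by (intro integrable_mult_right Bochner_Integration.integrable_add Bochner_Integration.integrable_diff int G G')
  have "integral\<^sup>L lborel ?E' = 0 - 0"
  proof (rule integral_FTC_real_line[where F = "\<lambda>v. e v * ?G v"])
    fix v :: real
    let ?C = "cosh (complex_of_real v)"
    have C: "?C \<noteq> 0" "?C\<^sup>2 + of_real y \<noteq> 0"
      using pos[of v] by (auto simp: cosh_complex_of_real simp flip: of_real_power of_real_add)
    \<comment> \<open>The three factors are differentiated as holomorphic functions of
      \<open>z\<close>, and the result is then restricted to the real line.\<close>
    let ?A = "\<lambda>z. exp (- \<i> * of_real y * tanh z)" and ?B = "\<lambda>z. exp (- 2 * \<i> * of_real l * z)"
      and ?K = "\<lambda>z::complex. cosh z / ((cosh z)\<^sup>2 + of_real y)"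
    let ?A' = "?A (of_real v) * (- \<i> * of_real y * (1 - (tanh (of_real v))\<^sup>2))"
      and ?B' = "?B (of_real v) * (- 2 * \<i> * of_real l)"
      and ?K' = "(sinh (of_real v) * (?C\<^sup>2 + of_real y) - ?C * (2 * ?C * sinh (of_real v))) / (?C\<^sup>2 + of_real y)\<^sup>2"
    let ?D = "?A (of_real v) * (?B (of_real v) * ?K' + ?B' * ?K (of_real v)) + ?A' * (?B (of_real v) * ?K (of_real v))"
    have "(?A has_field_derivative ?A') (at (of_real v))"
      using C by (auto intro!: derivative_eq_intros)
    moreover have "(?B has_field_derivative ?B') (at (of_real v))"
      by (auto intro!: derivative_eq_intros)
    moreover have "(?K has_field_derivative ?K') (at (of_real v))"
      using C(2) by (auto intro!: derivative_eq_intros simp: power2_eq_square)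
    ultimately have "((\<lambda>z. ?A z * (?B z * ?K z)) has_field_derivative ?D) (at (of_real v))"
      by (intro DERIV_mult')
    from has_vector_derivative_real_field[OF this, of UNIV]
    have "((\<lambda>v. e v * ?G v) has_vector_derivative ?D) (at v)"
      by (simp add: e_def p_def k_def tanh_def cosh_complex_of_real sinh_complex_of_real)
    moreover have "?D = ?E' v"
    proof -
      have e1: "1 - (tanh (complex_of_real v))\<^sup>2 = of_real (1 / (cosh v)\<^sup>2)"
        using one_minus_tanh_square[OF C(1)] by (simp add: cosh_complex_of_real)
      have e2: "(sinh (complex_of_real v) * (?C\<^sup>2 + of_real y) - ?C * (2 * ?C * sinh (of_real v))) / (?C\<^sup>2 + of_real y)\<^sup>2 = of_real (k' v)"
        by (simp add: k'_def cosh_complex_of_real sinh_complex_of_real algebra_simps power2_eq_square)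
      have e3: "?C / (?C\<^sup>2 + of_real y) = of_real (k v)"
        by (simp add: k_def cosh_complex_of_real)
      have e4: "exp (- \<i> * of_real y * tanh (of_real v)) = e v"
        by (simp add: e_def tanh_def cosh_complex_of_real sinh_complex_of_real)
      show ?thesis
        unfolding e1 e2 e3 e4 p_def by (simp add: algebra_simps)
    qed
    ultimately show "((\<lambda>v. e v * ?G v) has_vector_derivative ?E' v) (at v)" by simp
    show "isCont ?E' v"
      using cont by (intro continuous_intros) (auto simp: continuous_on_eq_continuous_at)
  next
    have lim: "(k \<longlongrightarrow> 0) F" if "filterlim (cosh :: real \<Rightarrow> real) at_top F" for F
    proof (rule Lim_null_comparison[OF always_eventually])
      show "\<forall>v. norm (k v) \<le> 1 / cosh v"
      proof
        fix v
        have "k v \<le> cosh v / (cosh v)\<^sup>2"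
          unfolding k_def using y by (intro divide_left_mono mult_pos_pos pos) auto
        then show "norm (k v) \<le> 1 / cosh v"
          using k0[of v] by (simp add: power2_eq_square)
      qed
      show "((\<lambda>v. 1 / cosh v) \<longlongrightarrow> 0) F"
        using that by (intro tendsto_divide_0[OF tendsto_const] filterlim_at_top_imp_at_infinity)
    qed
    have "((\<lambda>v. e v * ?G v) \<longlongrightarrow> 0) F" if "filterlim (cosh :: real \<Rightarrow> real) at_top F" for F
      by (rule Lim_null_comparison[OF always_eventually lim[OF that]]) (use k0 in \<open>auto simp: norm_mult ne\<close>)
    then show "((\<lambda>v. e v * ?G v) \<longlongrightarrow> 0) at_top" "((\<lambda>v. e v * ?G v) \<longlongrightarrow> 0) at_bot"
      using cosh_real_at_top cosh_real_at_bot by blast+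
  qed (rule E')
  then have E'0: "integral\<^sup>L lborel ?E' = 0" by simp
  have osc: "osc_transform l y = (LBINT v. e v * ?G v) + - \<i> * (LBINT v. e v * ?G' v)"
  proof -
    have "osc_transform l y = (LBINT v. e v * osc_sech l (of_real v))"
      by (simp only: osc_transform_def e_def)
    also have "\<dots> = (LBINT v. e v * ?G v + - \<i> * (e v * ?G' v) + \<i> * ?E' v)"
      by (simp only: split)
    also have "\<dots> = (LBINT v. e v * ?G v) + (LBINT v. - \<i> * (e v * ?G' v)) + (LBINT v. \<i> * ?E' v)"
      by (intro Bochner_Integration.integral_add[THEN trans] arg_cong2[where f = "(+)"] refl
          Bochner_Integration.integrable_add integrable_mult_right G G' E')
    also have "(LBINT v. - \<i> * (e v * ?G' v)) = - \<i> * (LBINT v. e v * ?G' v)"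
      by (rule integral_mult_right_zero)
    also have "(LBINT v. \<i> * ?E' v) = \<i> * (LBINT v. ?E' v)"
      by (rule integral_mult_right_zero)
    finally show ?thesis
      using E'0 by simp
  qed
  have "norm (osc_transform l y) \<le> norm (LBINT v. e v * ?G v) + norm (- \<i> * (LBINT v. e v * ?G' v))"
    unfolding osc by (rule norm_triangle_ineq)
  also have "norm (- \<i> * (LBINT v. e v * ?G' v)) = norm (LBINT v. e v * ?G' v)"
    by (simp only: norm_mult norm_minus_cancel norm_ii mult_1)
  also have "norm (LBINT v. e v * ?G v) + norm (LBINT v. e v * ?G' v) \<le> (LBINT v. k v) + (LBINT v. (2 * \<bar>l\<bar> + 1) * k v)"
  proof (rule add_mono)
    show "norm (LBINT v. e v * ?G v) \<le> integral\<^sup>L lborel k"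
      by (rule Bochner_Integration.integral_norm_bound_integral[OF G k(1)]) (simp add: norm_mult ne k0)
    show "norm (LBINT v. e v * ?G' v) \<le> (LBINT v. (2 * \<bar>l\<bar> + 1) * k v)"
      by (rule Bochner_Integration.integral_norm_bound_integral[OF G' integrable_mult_right[OF k(1)] G'_le])
  qed
  also have "\<dots> = (2 + 2 * \<bar>l\<bar>) * pi / sqrt (1 + y)"
    unfolding integral_mult_right_zero k(2) by (simp add: algebra_simps add_divide_distrib)
  finally show ?thesis .
qed

text \<open>Under \<open>t = tanh r\<close> this is the integral of \<open>exp (- \<i> u t)\<close>
  over \<open>[-1, 1]\<close>: the sinc kernel has constant spectral density there. Using the same
  coordinate as for the density lets the two Jacobians be compared pointwise later.\<close>

lemma
  shows integrable_exp_tanh_over: "integrable lborel (\<lambda>r. exp (- \<i> * of_real u * of_real (tanh r)) / of_real ((cosh r)\<^sup>2))"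
    and integral_exp_tanh_over: "(LBINT r. exp (- \<i> * of_real u * of_real (tanh r)) / of_real ((cosh r)\<^sup>2)) = of_real (2 * sinc u)"
proof -
  let ?f = "\<lambda>r. exp (- \<i> * of_real u * of_real (tanh r)) / complex_of_real ((cosh r)\<^sup>2)"
  show int: "integrable lborel ?f"
  proof (rule Bochner_Integration.integrable_bound[OF integrable_sech])
    show "?f \<in> borel_measurable lborel"
      by (auto intro!: borel_measurable_continuous_onI continuous_intros)
    have "1 / (cosh r)\<^sup>2 \<le> 1 / cosh r" for r :: real
      using cosh_real_ge_1[of r] by (simp add: power2_eq_square field_simps)
    then show "AE r in lborel. norm (?f r) \<le> norm (1 / cosh r)"
      by (simp add: norm_divide norm_power)
  qed
  have cont: "isCont ?f r" for r
    by (auto intro!: continuous_intros)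
  have tanh': "(tanh has_real_derivative 1 / (cosh r)\<^sup>2) (at r)" for r :: real
  proof -
    have "(tanh has_real_derivative (1 - (tanh r)\<^sup>2)) (at r)"
      by (auto intro!: derivative_eq_intros)
    then show ?thesis
      by (simp add: one_minus_tanh_square)
  qed
  show "integral\<^sup>L lborel ?f = of_real (2 * sinc u)"
  \<comment> \<open>The exponential primitive divides by \<open>u\<close>; at \<open>u = 0\<close>
    the primitive is \<open>tanh\<close> itself.\<close>
  proof (cases "u = 0")
    case True
    have "integral\<^sup>L lborel ?f = of_real 1 - of_real (- 1)"
    proof (rule integral_FTC_real_line[where F = "\<lambda>r. of_real (tanh r)"])
      show "((\<lambda>r. complex_of_real (tanh r)) has_vector_derivative ?f r) (at r)" for r
      proof -
        have "((\<lambda>r. complex_of_real (tanh r)) has_vector_derivative of_real (1 / (cosh r)\<^sup>2)) (at r)"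
          by (rule has_vector_derivative_of_real[OF tanh'])
        then show ?thesis using True by simp
      qed
      show "((\<lambda>r. complex_of_real (tanh r)) \<longlongrightarrow> of_real (- 1)) at_bot"
        by (intro tendsto_of_real tanh_real_at_bot)
      show "((\<lambda>r. complex_of_real (tanh r)) \<longlongrightarrow> of_real 1) at_top"
        by (intro tendsto_of_real tanh_real_at_top)
    qed (use cont int in auto)
    then show ?thesis using True by simp
  next
    case False
    let ?F = "\<lambda>z. \<i> * exp (- \<i> * of_real u * z) / of_real u"
    have "integral\<^sup>L lborel ?f = ?F (of_real 1) - ?F (of_real (- 1))"
    proof (rule integral_FTC_real_line[where F = "\<lambda>r. ?F (of_real (tanh r))"])
      fix r
      have "((?F \<circ> (\<lambda>r. of_real (tanh r))) has_vector_derivative of_real (1 / (cosh r)\<^sup>2) * exp (- \<i> * of_real u * of_real (tanh r))) (at r)"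
        using False by (intro field_vector_diff_chain_at has_vector_derivative_of_real tanh')
          (auto intro!: derivative_eq_intros)
      then show "((\<lambda>r. ?F (of_real (tanh r))) has_vector_derivative ?f r) (at r)"
        by (simp add: o_def)
    next
      have "((\<lambda>r. ?F (of_real (tanh r))) \<longlongrightarrow> ?F (of_real a)) F" if "(tanh \<longlongrightarrow> a) F" for F a
        using that False by (intro tendsto_intros tendsto_of_real) auto
      then show "((\<lambda>r. ?F (of_real (tanh r))) \<longlongrightarrow> ?F (of_real 1)) at_top"
        "((\<lambda>r. ?F (of_real (tanh r))) \<longlongrightarrow> ?F (of_real (- 1))) at_bot"
        using tanh_real_at_top tanh_real_at_bot by blast+
    qed (use cont int in auto)
    also have "\<dots> = of_real (2 * sin u / u)"
      using False by (simp add: complex_eq_iff Re_exp Im_exp)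
    finally show ?thesis using False by simp
  qed
qed

subsection \<open>The action of the damped kernel\<close>

lemma
  assumes "Re c > 0"
  shows integrable_exp_halfline: "integrable lborel (\<lambda>y. indicator {0<..} y *\<^sub>R exp (- c * of_real y))"
    and integral_exp_halfline: "(LBINT y. indicator {0<..} y *\<^sub>R exp (- c * of_real y)) = 1 / c"
proof -
  have c: "c \<noteq> 0" using assms by auto
  have norm: "norm (exp (- c * of_real y)) = exp (- (y * Re c))" for y
    by (simp add: mult.commute)
  have "integrable lborel (\<lambda>y. indicator {0<..} y * exp (- (y * Re c)))"
    using integrable_I0i_exp_mscale[OF assms] by (simp add: set_integrable_def)
  then show int: "integrable lborel (\<lambda>y. indicator {0<..} y *\<^sub>R exp (- c * of_real y))"
    by (rule Bochner_Integration.integrable_bound) (auto simp: norm mult.commute simp del: mult_minus_left)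
  have "(LBINT y=0..\<infinity>. exp (- c * of_real y)) = 0 - (- 1 / c)"
  proof (rule interval_integral_FTC_integrable)
    show "((\<lambda>y. - exp (- c * of_real y) / c) has_vector_derivative exp (- c * of_real y)) (at y)" for y :: real
    proof (rule has_vector_derivative_real_field)
      show "((\<lambda>z. - exp (- c * z) / c) has_field_derivative exp (- c * of_real y)) (at (of_real y))"
        using c by (auto intro!: derivative_eq_intros)
    qed
    show "set_integrable lborel (einterval 0 \<infinity>) (\<lambda>y. exp (- c * of_real y))"
      using int by (simp add: set_integrable_def zero_ereal_def)
    have "((\<lambda>y. exp (- (y * Re c))) \<longlongrightarrow> 0) at_top"
      using assms by real_asymp
    then have "((\<lambda>y. exp (- c * of_real y)) \<longlongrightarrow> 0) at_top"
      by (subst tendsto_norm_zero_iff[symmetric]) (simp only: norm)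
    from tendsto_divide[OF tendsto_minus[OF this] tendsto_const c]
    show "(((\<lambda>y. - exp (- c * of_real y) / c) \<circ> real_of_ereal) \<longlongrightarrow> 0) (at_left \<infinity>)"
      by (simp add: ereal_tendsto_simps)
    have "((\<lambda>y. - exp (- c * of_real y) / c) \<longlongrightarrow> - exp (- c * of_real 0) / c) (at_right 0)"
      using c by (intro tendsto_intros) auto
    then show "(((\<lambda>y. - exp (- c * of_real y) / c) \<circ> real_of_ereal) \<longlongrightarrow> - 1 / c) (at_right 0)"
      by (simp add: ereal_tendsto_simps zero_ereal_def)
  qed (auto intro!: continuous_intros)
  then show "(LBINT y. indicator {0<..} y *\<^sub>R exp (- c * of_real y)) = 1 / c"
    by (simp add: interval_lebesgue_integral_0_infty set_lebesgue_integral_def)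
qed

lemma borel_measurable_cosh [measurable]: "(cosh :: real \<Rightarrow> real) \<in> borel_measurable borel"
  by (auto intro!: borel_measurable_continuous_onI continuous_intros)

lemma borel_measurable_osc_transform [measurable]: "osc_transform l \<in> borel_measurable borel"
  unfolding osc_transform_def [abs_def] by measurable

lemma norm_osc_transform_bounded:
  assumes "y > 0"
  shows "norm (osc_transform l y) \<le> (2 + 2 * \<bar>l\<bar>) * pi"
proof -
  have "(2 + 2 * \<bar>l\<bar>) * pi / sqrt (1 + y) \<le> (2 + 2 * \<bar>l\<bar>) * pi / 1"
    using assms by (intro divide_left_mono) auto
  then show ?thesis using norm_osc_transform_le[of y l] assms by simp
qed

lemma integrable_exp_halfline_real:
  assumes "e > 0"
  shows "integrable lborel (\<lambda>y. indicator {0<..} y * exp (- e * y) :: real)"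
  using integrable_I0i_exp_mscale[OF assms] by (simp add: set_integrable_def mult.commute)

text \<open>Here the restriction to the half line takes effect: integrating over
  \<open>y > 0\<close> turns each frequency \<open>tanh v\<close> into a Cauchy kernel at the point
  \<open>t + \<i> e\<close> just above the cut. The factor \<open>\<i>\<close> arises from
  \<open>1 / c = \<i> / (\<i> * c)\<close>.\<close>

lemma laplace_osc_transform:
  assumes e: "e > 0"
  shows "(LBINT y. indicator {0<..} y *\<^sub>R (exp (- (of_real e - \<i> * of_real t) * of_real y) * osc_transform l y))
     = \<i> * (LBINT v. osc_sech l (of_real v) / (of_real t + \<i> * of_real e - of_real (tanh v)))"
proof -
  let ?F = "\<lambda>y v. indicator {0<..} y *\<^sub>R (exp (- (of_real e - \<i> * of_real t) * of_real y) *
      (exp (- \<i> * of_real y * of_real (tanh v)) * osc_sech l (of_real v)))"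
  have meas: "case_prod ?F \<in> borel_measurable (lborel \<Otimes>\<^sub>M lborel)"
    by measurable
  have bound: "norm (?F y v) \<le> (indicator {0<..} y * exp (- e * y)) * (1 / cosh v)" for y v
    by (simp add: norm_mult norm_osc_sech_real)
  have inner: "(LBINT y. ?F y v) = \<i> * (osc_sech l (of_real v) / (of_real t + \<i> * of_real e - of_real (tanh v)))" for v
  proof -
    define c where "c = of_real e - \<i> * of_real t + \<i> * of_real (tanh v)"
    have "Re c > 0" using e by (simp add: c_def)
    have "?F y v = (indicator {0<..} y *\<^sub>R exp (- c * of_real y)) * osc_sech l (of_real v)" for y
      by (simp add: c_def algebra_simps flip: exp_add)
    then have "(LBINT y. ?F y v) = (LBINT y. indicator {0<..} y *\<^sub>R exp (- c * of_real y)) * osc_sech l (of_real v)"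
      by (simp only: integral_mult_left_zero)
    also have "\<dots> = 1 / c * osc_sech l (of_real v)"
      by (simp only: integral_exp_halfline[OF \<open>Re c > 0\<close>])
    also have "1 / c = \<i> / (\<i> * c)" by simp
    also have "\<i> * c = of_real t + \<i> * of_real e - of_real (tanh v)"
      by (simp add: c_def algebra_simps)
    finally show ?thesis by simp
  qed
  have "(LBINT y. indicator {0<..} y *\<^sub>R (exp (- (of_real e - \<i> * of_real t) * of_real y) * osc_transform l y))
      = (LBINT y. LBINT v. ?F y v)"
    unfolding osc_transform_def by (simp only: integral_mult_right_zero integral_scaleR_right)
  also have "\<dots> = (LBINT v. LBINT y. ?F y v)"
    by (rule Fubini_product_bound[OF meas integrable_exp_halfline_real[OF e] integrable_sech bound])
  finally show ?thesis
    unfolding inner by (simp only: integral_mult_right_zero)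
qed

text \<open>The sinc factor is expanded over its spectrum and the integrals are interchanged. The
  damping makes this legitimate, as the transform is bounded. The inner integral over
  \<open>y\<close> is then \<open>laplace_osc_transform\<close> at
  \<open>t = tanh r\<close>.\<close>

lemma damped_sinc_osc_transform:
  assumes e: "e > 0"
  shows "(LBINT y. indicator {0<..} y *\<^sub>R (of_real (exp (- e * y)) * (of_real (sinc (x - y)) * osc_transform l y)))
     = \<i> / 2 * (LBINT r. exp (- \<i> * of_real x * of_real (tanh r)) / of_real ((cosh r)\<^sup>2) *
           (LBINT v. osc_sech l (of_real v) / (of_real (tanh r) + \<i> * of_real e - of_real (tanh v))))"
proof -
  define M where "M = (2 + 2 * \<bar>l\<bar>) * pi"
  let ?F = "\<lambda>r y. exp (- \<i> * of_real (x - y) * of_real (tanh r)) / complex_of_real ((cosh r)\<^sup>2) *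
      (indicator {0<..} y *\<^sub>R (of_real (exp (- e * y)) * osc_transform l y))"
  have meas: "case_prod ?F \<in> borel_measurable (lborel \<Otimes>\<^sub>M lborel)"
    by measurable
  have bound: "norm (?F r y) \<le> (1 / cosh r) * (M * (indicator {0<..} y * exp (- e * y)))" for r y
  proof -
    have "norm (?F r y) = 1 / (cosh r)\<^sup>2 * (indicator {0<..} y * (exp (- e * y) * norm (osc_transform l y)))"
      by (simp add: norm_mult norm_divide norm_power)
    also have "\<dots> \<le> (1 / cosh r) * (indicator {0<..} y * (exp (- e * y) * M))"
    proof (rule mult_mono)
      show "1 / (cosh r)\<^sup>2 \<le> 1 / cosh r"
        using cosh_real_ge_1[of r] by (simp add: power2_eq_square field_simps)
      show "indicator {0<..} y * (exp (- e * y) * norm (osc_transform l y)) \<le> indicator {0<..} y * (exp (- e * y) * M)"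
        using norm_osc_transform_bounded[of y l] by (auto simp: indicator_def M_def)
    qed auto
    finally show ?thesis by (simp add: mult_ac)
  qed
  have "(LBINT y. indicator {0<..} y *\<^sub>R (of_real (exp (- e * y)) * (of_real (sinc (x - y)) * osc_transform l y)))
     = 1 / 2 * (LBINT y. LBINT r. ?F r y)"
  proof -
    have "1 / 2 * (LBINT r. ?F r y) = indicator {0<..} y *\<^sub>R (of_real (exp (- e * y)) * (of_real (sinc (x - y)) * osc_transform l y))" for y
      unfolding integral_mult_left_zero integral_exp_tanh_over by simp
    then show ?thesis
      unfolding integral_mult_right_zero [symmetric] by (simp only:)
  qed
  also have "(LBINT y. LBINT r. ?F r y) = (LBINT r. LBINT y. ?F r y)"
    by (rule Fubini_product_bound[OF meas integrable_sech integrable_mult_right[OF integrable_exp_halfline_real[OF e]] bound, symmetric])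
  also have "\<dots> = (LBINT r. exp (- \<i> * of_real x * of_real (tanh r)) / of_real ((cosh r)\<^sup>2) *
           (\<i> * (LBINT v. osc_sech l (of_real v) / (of_real (tanh r) + \<i> * of_real e - of_real (tanh v)))))"
  proof (rule arg_cong[where f = "integral\<^sup>L lborel"], rule ext)
    fix r
    have "?F r y = exp (- \<i> * of_real x * of_real (tanh r)) / complex_of_real ((cosh r)\<^sup>2) *
        (indicator {0<..} y *\<^sub>R (exp (- (of_real e - \<i> * of_real (tanh r)) * of_real y) * osc_transform l y))" for y
    proof -
      have phase: "exp (- \<i> * of_real (x - y) * of_real (tanh r)) * of_real (exp (- e * y))
        = exp (- \<i> * of_real x * of_real (tanh r)) * exp (- (of_real e - \<i> * of_real (tanh r)) * of_real y)"
        unfolding exp_of_real [symmetric] exp_add [symmetric] by (rule arg_cong[where f = exp]) (simp add: algebra_simps)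
      have merge: "a / c * (k *\<^sub>R (d * h)) = a * d / c * (k *\<^sub>R h)" for a c d h :: complex and k
        by (simp add: scaleR_conv_of_real mult_ac)
      show ?thesis unfolding merge phase ..
    qed
    then show "(LBINT y. ?F r y) = exp (- \<i> * of_real x * of_real (tanh r)) / of_real ((cosh r)\<^sup>2) *
           (\<i> * (LBINT v. osc_sech l (of_real v) / (of_real (tanh r) + \<i> * of_real e - of_real (tanh v))))"
      by (simp only: integral_mult_right_zero laplace_osc_transform[OF e])
  qed
  also have "\<dots> = \<i> * (LBINT r. exp (- \<i> * of_real x * of_real (tanh r)) / of_real ((cosh r)\<^sup>2) *
           (LBINT v. osc_sech l (of_real v) / (of_real (tanh r) + \<i> * of_real e - of_real (tanh v))))"
    unfolding integral_mult_right_zero [symmetric] by (simp only: mult.left_commute)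
  finally show ?thesis by simp
qed

section \<open>Absolute convergence without damping\<close>

lemma abs_sinc_le:
  assumes "x > 0" "y > 0"
  shows "\<bar>sinc (x - y)\<bar> \<le> (x + 2) / (1 + y)"
proof -
  define u where "u = x - y"
  have S: "\<bar>sinc u\<bar> \<le> 1" "\<bar>u\<bar> * \<bar>sinc u\<bar> \<le> 1"
    using abs_sin_x_le_abs_x[of u] abs_sin_le_one[of u] by (auto simp: abs_mult divide_le_eq)
  \<comment> \<open>From \<open>y \<le> x + \<bar>u\<bar>\<close> the two bounds in \<open>S\<close>
    apply separately; they contribute \<open>1 + x\<close> and 1, whence the constant
    \<open>x + 2\<close>.\<close>
  have "(1 + y) * \<bar>sinc u\<bar> \<le> (1 + x + \<bar>u\<bar>) * \<bar>sinc u\<bar>"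
    by (rule mult_right_mono) (auto simp: u_def)
  also have "\<dots> = (1 + x) * \<bar>sinc u\<bar> + \<bar>u\<bar> * \<bar>sinc u\<bar>"
    by (rule distrib_right)
  also have "\<dots> \<le> (1 + x) * 1 + 1"
    using S assms by (intro add_mono mult_left_mono) auto
  finally have "(1 + y) * \<bar>sinc u\<bar> \<le> x + 2" by simp
  then have "\<bar>sinc u\<bar> \<le> (x + 2) / (1 + y)"
    using assms(2) by (subst pos_le_divide_eq) (simp_all only: mult.commute)
  then show ?thesis by (simp only: u_def)
qed

text \<open>The exponent 3/2 collects 1 from sinc and 1/2 from the transform; a primitive is
  \<open>- 2 / sqrt (1 + y)\<close>.\<close>

lemma integrable_three_halves_decay:
  "integrable lborel (\<lambda>y. indicator {0<..} y * (1 / ((1 + y) * sqrt (1 + y))) :: real)"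
proof -
  have "set_integrable lborel (einterval 0 \<infinity>) (\<lambda>y. 1 / ((1 + y) * sqrt (1 + y)))"
  proof (rule interval_integral_FTC_nonneg)
    let ?F = "\<lambda>y::real. - 2 / sqrt (1 + y)"
    show "DERIV ?F y :> 1 / ((1 + y) * sqrt (1 + y))" if "0 < ereal y" for y
      using that by (auto intro!: derivative_eq_intros simp: field_simps)
    have "(?F \<longlongrightarrow> 0) at_top" by real_asymp
    then show "((?F \<circ> real_of_ereal) \<longlongrightarrow> 0) (at_left \<infinity>)"
      by (simp add: ereal_tendsto_simps)
    have "(?F \<longlongrightarrow> - 2 / sqrt (1 + 0)) (at_right 0)"
      by (intro tendsto_intros) auto
    then show "((?F \<circ> real_of_ereal) \<longlongrightarrow> - 2) (at_right 0)"
      by (simp add: ereal_tendsto_simps zero_ereal_def)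
  qed (auto intro!: continuous_intros AE_I2)
  then show ?thesis
    by (simp add: set_integrable_def zero_ereal_def)
qed

lemma norm_sinc_osc_transform_le:
  assumes x: "x > 0" and y: "y > 0"
  shows "norm (of_real (sinc (x - y)) * osc_transform l y)
      \<le> (x + 2) * ((2 + 2 * \<bar>l\<bar>) * pi) * (1 / ((1 + y) * sqrt (1 + y)))"
proof -
  have "norm (of_real (sinc (x - y)) * osc_transform l y) = \<bar>sinc (x - y)\<bar> * norm (osc_transform l y)"
    by (simp only: norm_mult norm_of_real)
  also have "\<dots> \<le> (x + 2) / (1 + y) * ((2 + 2 * \<bar>l\<bar>) * pi / sqrt (1 + y))"
    using x y by (intro mult_mono abs_sinc_le norm_osc_transform_le) auto
  also have "\<dots> = (x + 2) * ((2 + 2 * \<bar>l\<bar>) * pi) * (1 / ((1 + y) * sqrt (1 + y)))"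
    by simp
  finally show ?thesis .
qed

text \<open>This supplies both the integrability asserted in the theorem and the dominating function
  for removing the damping.\<close>

lemma integrable_sinc_osc_transform:
  assumes "x > 0"
  shows "integrable lborel (\<lambda>y. indicator {0<..} y *\<^sub>R (of_real (sinc (x - y)) * osc_transform l y))"
proof (rule Bochner_Integration.integrable_bound[OF integrable_mult_right[OF integrable_three_halves_decay, of "(x + 2) * ((2 + 2 * \<bar>l\<bar>) * pi)"]])
  show "AE y in lborel. norm (indicator {0<..} y *\<^sub>R (of_real (sinc (x - y)) * osc_transform l y))
      \<le> norm ((x + 2) * ((2 + 2 * \<bar>l\<bar>) * pi) * (indicator {0<..} y * (1 / ((1 + y) * sqrt (1 + y)))))"
  proof (rule AE_I2)
    fix y
    show "norm (indicator {0<..} y *\<^sub>R (of_real (sinc (x - y)) * osc_transform l y))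
      \<le> norm ((x + 2) * ((2 + 2 * \<bar>l\<bar>) * pi) * (indicator {0<..} y * (1 / ((1 + y) * sqrt (1 + y)))))"
    proof (cases "y > 0")
      case True
      then have ind: "indicator {0<..} y = (1 :: real)" by simp
      show ?thesis
        unfolding ind scaleR_one mult_1 real_norm_def
        by (rule order_trans[OF norm_sinc_osc_transform_le[OF assms True] abs_ge_self])
    next
      case False
      then have ind: "indicator {0<..} y = (0 :: real)" by simp
      show ?thesis unfolding ind scaleR_zero_left norm_zero by (rule norm_ge_zero)
    qed
  qed
qed measurable

subsection \<open>Passage to the boundary\<close>

text \<open>The imaginary power contributes at most \<open>exp (pi * \<bar>l\<bar>)\<close>, since
  the argument lies between 0 and \<open>pi\<close>. What remains is the inverse square root of
  \<open>norm (w - 1) * norm (w + 1)\<close>, and this product is at least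
  \<open>(1 - tanh r) * (1 + tanh r) = 1 / (cosh r)\<^sup>2\<close>. The bound is uniform in
  \<open>e\<close>, as dominated convergence requires.\<close>

lemma norm_boundary_factor_le:
  fixes r e l :: real
  assumes e: "e > 0"
  defines "w \<equiv> of_real (tanh r) + \<i> * of_real e"
  shows "norm (exp ((\<i> * of_real l - 1/2) * Ln ((w - 1) / (w + 1))) / (w + 1)) \<le> exp (pi * \<bar>l\<bar>) * cosh r"
proof -
  define z where "z = (w - 1) / (w + 1)"
  have w: "Im w > 0" using e by (simp add: w_def)
  have z: "Im z > 0" "z \<noteq> 0" and w1: "w + 1 \<noteq> 0" "w - 1 \<noteq> 0"
    using Im_moebius_pos[OF w] w unfolding z_def by (force simp: complex_eq_iff)+
  define N where "N = exp (- ln (norm z) / 2)"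
  have N2: "N\<^sup>2 = norm (w + 1) / norm (w - 1)"
  proof -
    have "N\<^sup>2 = exp (- ln (norm z))"
      by (simp add: N_def power2_eq_square flip: exp_add)
    also have "\<dots> = inverse (norm z)" using z(2) by (simp add: exp_minus)
    finally show ?thesis by (simp add: z_def norm_divide)
  qed
  have "norm (exp ((\<i> * of_real l - 1/2) * Ln z) / (w + 1)) = exp (- l * Im (Ln z)) * (N / norm (w + 1))"
    using z(2) by (simp add: norm_divide N_def flip: exp_add)
  also have "\<dots> \<le> exp (pi * \<bar>l\<bar>) * cosh r"
  proof (rule mult_mono)
    have "\<bar>l * Im (Ln z)\<bar> \<le> \<bar>l\<bar> * pi"
      unfolding abs_mult using Im_Ln_pos_lt_imp[OF z(1)] by (intro mult_left_mono) auto
    then show "exp (- l * Im (Ln z)) \<le> exp (pi * \<bar>l\<bar>)"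
      by (simp add: abs_le_iff mult.commute)
    show "N / norm (w + 1) \<le> cosh r"
    proof (rule power2_le_imp_le)
      have "1 - tanh r \<le> norm (w - 1)"
        using abs_Re_le_cmod[of "w - 1"] by (simp add: w_def)
      moreover have "1 + tanh r \<le> norm (w + 1)"
        using abs_Re_le_cmod[of "w + 1"] by (simp add: w_def)
      ultimately have "(1 - tanh r) * (1 + tanh r) \<le> norm (w - 1) * norm (w + 1)"
        using abs_tanh_less_1[of r] by (intro mult_mono) auto
      moreover have "(1 - tanh r) * (1 + tanh r) = 1 / (cosh r)\<^sup>2"
        using one_minus_tanh_square[of r] by (simp add: power2_eq_square algebra_simps)
      ultimately have le: "1 / (cosh r)\<^sup>2 \<le> norm (w - 1) * norm (w + 1)" by simp
      have "(N / norm (w + 1))\<^sup>2 = 1 / (norm (w - 1) * norm (w + 1))"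
        unfolding power_divide N2 using w1 by (simp add: power2_eq_square)
      also have "\<dots> \<le> 1 / (1 / (cosh r)\<^sup>2)"
        using le w1 by (intro divide_left_mono) auto
      finally show "(N / norm (w + 1))\<^sup>2 \<le> (cosh r)\<^sup>2" by simp
    qed simp
  qed (auto simp: N_def)
  finally show ?thesis by (simp only: z_def)
qed

text \<open>The quotient tends to \<open>- exp (- 2 * r)\<close>, a point on the cut of the
  logarithm, approached from the upper half plane; hence the logarithm tends to
  \<open>- 2 * r + \<i> * pi\<close>. This one-sided limit produces the factor
  \<open>exp (- pi * l)\<close> that determines the eigenvalue.\<close>

lemma tendsto_boundary_factor:
  fixes e :: "nat \<Rightarrow> real" and r l :: real
  assumes e: "e \<longlonglongrightarrow> 0" "\<And>n. e n > 0"
  defines "w \<equiv> \<lambda>n. of_real (tanh r) + \<i> * of_real (e n)"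
  shows "(\<lambda>n. exp ((\<i> * of_real l - 1/2) * Ln ((w n - 1) / (w n + 1))) / (w n + 1))
     \<longlonglongrightarrow> - \<i> * of_real (exp (- pi * l)) * osc_sech l (of_real r) * of_real ((cosh r)\<^sup>2)"
proof -
  have w: "w \<longlonglongrightarrow> of_real (tanh r)"
    unfolding w_def using tendsto_add[OF tendsto_const tendsto_mult[OF tendsto_const tendsto_of_real[OF e(1)]]]
    by (rule tendsto_eq_rhs) simp
  have t1: "1 + tanh r = exp r / cosh r" "1 - tanh r = exp (- r) / cosh r"
    by (simp_all add: tanh_def field_simps cosh_plus_sinh cosh_minus_sinh)
  have one: "of_real (tanh r) + 1 = complex_of_real (exp r / cosh r)"
    unfolding t1(1) [symmetric] by simp
  have nz: "of_real (tanh r) + 1 \<noteq> (0 :: complex)"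
    unfolding one by simp
  \<comment> \<open>Negating the quotient moves its limit to the positive axis, where
    \<open>Ln\<close> is continuous; \<open>\<i> * pi\<close> is added back afterwards.\<close>
  have "(\<lambda>n. - ((w n - 1) / (w n + 1))) \<longlonglongrightarrow> - ((of_real (tanh r) - 1) / (of_real (tanh r) + 1))"
    by (intro tendsto_intros w nz)
  moreover have "- ((of_real (tanh r) - 1) / (of_real (tanh r) + 1)) = complex_of_real (exp (- 2 * r))"
  proof -
    have "- ((of_real (tanh r) - 1) / (of_real (tanh r) + 1)) = complex_of_real ((1 - tanh r) / (1 + tanh r))"
      unfolding minus_divide_left minus_diff_eq by (simp add: add.commute)
    also have "(1 - tanh r) / (1 + tanh r) = exp (- 2 * r)"
      unfolding t1 by (simp add: exp_minus field_simps flip: exp_add)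
    finally show ?thesis .
  qed
  ultimately have "(\<lambda>n. Ln (- ((w n - 1) / (w n + 1)))) \<longlonglongrightarrow> Ln (of_real (exp (- 2 * r)))"
    by (intro tendsto_Ln) (auto simp: complex_nonpos_Reals_iff)
  also have "Ln (of_real (exp (- 2 * r))) = of_real (- 2 * r)"
    by (subst Ln_of_real) auto
  finally have "(\<lambda>n. Ln (- ((w n - 1) / (w n + 1))) + \<i> * pi) \<longlonglongrightarrow> of_real (- 2 * r) + \<i> * pi"
    by (intro tendsto_intros)
  also have "(\<lambda>n. Ln (- ((w n - 1) / (w n + 1))) + \<i> * pi) = (\<lambda>n. Ln ((w n - 1) / (w n + 1)))"
  proof
    fix n
    have "Im ((w n - 1) / (w n + 1)) > 0"
      by (rule Im_moebius_pos) (simp add: w_def e)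
    then show "Ln (- ((w n - 1) / (w n + 1))) + \<i> * pi = Ln ((w n - 1) / (w n + 1))"
      by (subst Ln_minus) auto
  qed
  finally have lnlim: "(\<lambda>n. Ln ((w n - 1) / (w n + 1))) \<longlonglongrightarrow> of_real (- 2 * r) + \<i> * pi" .
  have "(\<lambda>n. exp ((\<i> * of_real l - 1/2) * Ln ((w n - 1) / (w n + 1))) / (w n + 1))
      \<longlonglongrightarrow> exp ((\<i> * of_real l - 1/2) * (of_real (- 2 * r) + \<i> * pi)) / (of_real (tanh r) + 1)"
    by (intro tendsto_divide tendsto_exp tendsto_mult tendsto_add tendsto_const lnlim w nz)
  \<comment> \<open>The four products of the exponents: \<open>-1/2\<close> times
    \<open>\<i> pi\<close> gives \<open>- \<i>\<close>, \<open>\<i> l\<close> times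
    \<open>\<i> pi\<close> gives \<open>exp (- pi * l)\<close>, and the terms with \<open>r\<close>
    give the oscillation and \<open>exp r\<close>. Dividing \<open>exp r\<close> by
    \<open>1 + tanh r\<close> leaves \<open>cosh r\<close>.\<close>
  also have "exp ((\<i> * of_real l - 1/2) * (of_real (- 2 * r) + \<i> * pi))
      = exp (- (\<i> * of_real (pi / 2))) * of_real (exp (- pi * l)) * exp (- 2 * \<i> * of_real l * of_real r) * of_real (exp r)"
    unfolding exp_of_real [symmetric] exp_add [symmetric]
    by (rule arg_cong[where f = exp]) (simp add: algebra_simps)
  also have "exp (- (\<i> * of_real (pi / 2))) = - \<i>"
    by (simp add: complex_eq_iff Re_exp Im_exp)
  also have "- \<i> * of_real (exp (- pi * l)) * exp (- 2 * \<i> * of_real l * of_real r) * of_real (exp r) / (of_real (tanh r) + 1)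
      = - \<i> * of_real (exp (- pi * l)) * osc_sech l (of_real r) * of_real ((cosh r)\<^sup>2)"
    unfolding one osc_sech_def cosh_complex_of_real by (simp add: power2_eq_square)
  finally show ?thesis .
qed

text \<open>The damped identity passes to the limit on both sides. On the left the undamped
  integrand dominates, on the right \<open>exp (pi * \<bar>l\<bar>) / cosh r\<close> does. The
  eigenvalue comes from multiplying \<open>\<i> / 2\<close>, \<open>J = pi / cosh (pi * l)\<close>
  and \<open>- \<i> * exp (- pi * l)\<close>.\<close>

lemma integral_sinc_osc_transform:
  assumes x: "x > 0"
  shows "(LBINT y. indicator {0<..} y *\<^sub>R (of_real (sinc (x - y)) * osc_transform l y))
       = of_real (pi * (exp (- pi * l) / (2 * cosh (pi * l)))) * osc_transform l x"
proof -
  \<comment> \<open>A sequence of damping parameters, so that dominated convergence applies in its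
    sequential form.\<close>
  define e where "e = (\<lambda>n. inverse (real (Suc n)))"
  have e: "e \<longlonglongrightarrow> 0" "e n > 0" for n
    unfolding e_def by (rule LIMSEQ_inverse_real_of_nat) simp
  define J where "J = pi / cosh (pi * l)"
  define \<Phi> where "\<Phi> = (\<lambda>n r. exp ((\<i> * of_real l - 1/2) *
      Ln ((of_real (tanh r) + \<i> * of_real (e n) - 1) / (of_real (tanh r) + \<i> * of_real (e n) + 1)))
      / (of_real (tanh r) + \<i> * of_real (e n) + 1))"
  have [measurable]: "\<Phi> n \<in> borel_measurable borel" for n
    unfolding \<Phi>_def by measurable
  define c where "c = (\<lambda>r. exp (- \<i> * of_real x * of_real (tanh r)) / complex_of_real ((cosh r)\<^sup>2))"
  have [measurable]: "c \<in> borel_measurable borel"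
    unfolding c_def by measurable
  let ?f = "\<lambda>y. indicator {0<..} y *\<^sub>R (of_real (sinc (x - y)) * osc_transform l y)"
  let ?fn = "\<lambda>n y. indicator {0<..} y *\<^sub>R (of_real (exp (- e n * y)) * (of_real (sinc (x - y)) * osc_transform l y))"
  have fn: "(LBINT y. ?fn n y) = \<i> / 2 * of_real J * (LBINT r. c r * \<Phi> n r)" for n
  proof -
    have "(LBINT v. osc_sech l (of_real v) / (of_real (tanh r) + \<i> * of_real (e n) - of_real (tanh v)))
        = of_real J * \<Phi> n r" for r
      unfolding J_def \<Phi>_def using e(2)[of n] by (intro integral_osc_sech_over) simp
    then have "(LBINT y. ?fn n y) = \<i> / 2 * (LBINT r. of_real J * (c r * \<Phi> n r))"
      unfolding damped_sinc_osc_transform[OF e(2)] by (simp only: c_def mult.left_commute)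
    then show ?thesis
      by (simp only: integral_mult_right_zero mult.assoc)
  qed
  have "(\<lambda>n. LBINT y. ?fn n y) \<longlonglongrightarrow> (LBINT y. ?f y)"
  proof (rule integral_dominated_convergence)
    show "integrable lborel (\<lambda>y. norm (?f y))"
      by (intro integrable_norm integrable_sinc_osc_transform x)
    show "AE y in lborel. (\<lambda>n. ?fn n y) \<longlonglongrightarrow> ?f y"
    proof (rule AE_I2)
      fix y
      have "(\<lambda>n. exp (- e n * y)) \<longlonglongrightarrow> exp (- 0 * y)"
        by (intro tendsto_intros e)
      then have "(\<lambda>n. complex_of_real (exp (- e n * y))) \<longlonglongrightarrow> of_real (exp (- 0 * y))"
        by (rule tendsto_of_real)
      then have "(\<lambda>n. ?fn n y) \<longlonglongrightarrow> indicator {0<..} y *\<^sub>R (of_real (exp (- 0 * y)) * (of_real (sinc (x - y)) * osc_transform l y))"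
        by (intro tendsto_scaleR tendsto_const tendsto_mult)
      then show "(\<lambda>n. ?fn n y) \<longlonglongrightarrow> ?f y"
        by (simp only: minus_zero mult_zero_left exp_zero of_real_1 mult_1)
    qed
    show "AE y in lborel. norm (?fn n y) \<le> norm (?f y)" for n
    proof (rule AE_I2)
      fix y
      have "indicator {0<..} y * exp (- e n * y) * N \<le> indicator {0<..} y * N" if "N \<ge> 0" for N :: real
        using that e(2)[of n] by (cases "y > 0") (auto intro!: mult_left_le_one_le)
      from this[of "norm (of_real (sinc (x - y)) * osc_transform l y)"]
      show "norm (?fn n y) \<le> norm (?f y)"
        unfolding norm_scaleR norm_mult[of "of_real (exp _)"] norm_of_real by (simp only: abs_indicator abs_exp_cancel mult.assoc norm_ge_zero)
    qed
  qed measurable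
  moreover have "(\<lambda>n. \<i> / 2 * of_real J * (LBINT r. c r * \<Phi> n r)) \<longlonglongrightarrow>
      \<i> / 2 * of_real J * (LBINT r. - \<i> * of_real (exp (- pi * l)) * (exp (- \<i> * of_real x * of_real (tanh r)) * osc_sech l (of_real r)))"
  proof (intro tendsto_mult tendsto_const integral_dominated_convergence)
    show "integrable lborel (\<lambda>r. exp (pi * \<bar>l\<bar>) * (1 / cosh r))"
      by (intro integrable_mult_right integrable_sech)
    show "AE r in lborel. (\<lambda>n. c r * \<Phi> n r) \<longlonglongrightarrow>
        - \<i> * of_real (exp (- pi * l)) * (exp (- \<i> * of_real x * of_real (tanh r)) * osc_sech l (of_real r))"
    proof (rule AE_I2)
      fix r
      have "(\<lambda>n. c r * \<Phi> n r) \<longlonglongrightarrow> c r * (- \<i> * of_real (exp (- pi * l)) * osc_sech l (of_real r) * of_real ((cosh r)\<^sup>2))"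
        unfolding \<Phi>_def by (intro tendsto_mult[OF tendsto_const] tendsto_boundary_factor e)
      \<comment> \<open>The factor \<open>(cosh r)\<^sup>2\<close> of the boundary value cancels the
        Jacobian of the sinc spectrum, so the integrand of \<open>osc_transform\<close>
        reappears.\<close>
      also have "c r * (- \<i> * of_real (exp (- pi * l)) * osc_sech l (of_real r) * of_real ((cosh r)\<^sup>2))
          = - \<i> * of_real (exp (- pi * l)) * (exp (- \<i> * of_real x * of_real (tanh r)) * osc_sech l (of_real r))"
      proof -
        have "a / d * (p * g * d) = p * (a * g)" if "d \<noteq> 0" for a d p g :: complex
          using that by simp
        moreover have "complex_of_real ((cosh r)\<^sup>2) \<noteq> 0" by simp
        ultimately show ?thesis unfolding c_def by blast
      qed
      finally show "(\<lambda>n. c r * \<Phi> n r) \<longlonglongrightarrow>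
        - \<i> * of_real (exp (- pi * l)) * (exp (- \<i> * of_real x * of_real (tanh r)) * osc_sech l (of_real r))" .
    qed
    show "AE r in lborel. norm (c r * \<Phi> n r) \<le> exp (pi * \<bar>l\<bar>) * (1 / cosh r)" for n
    proof (rule AE_I2)
      fix r
      have "norm (c r * \<Phi> n r) = 1 / (cosh r)\<^sup>2 * norm (\<Phi> n r)"
        by (simp add: c_def norm_mult norm_divide norm_power)
      also have "\<dots> \<le> 1 / (cosh r)\<^sup>2 * (exp (pi * \<bar>l\<bar>) * cosh r)"
        unfolding \<Phi>_def by (intro mult_left_mono norm_boundary_factor_le e) auto
      also have "\<dots> = exp (pi * \<bar>l\<bar>) * (1 / cosh r)"
        by (simp add: power2_eq_square)
      finally show "norm (c r * \<Phi> n r) \<le> exp (pi * \<bar>l\<bar>) * (1 / cosh r)" .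
    qed
  qed measurable
  ultimately have "(LBINT y. ?f y) = \<i> / 2 * of_real J * (LBINT r. - \<i> * of_real (exp (- pi * l)) * (exp (- \<i> * of_real x * of_real (tanh r)) * osc_sech l (of_real r)))"
    unfolding fn by (rule LIMSEQ_unique)
  also have "\<dots> = \<i> / 2 * of_real J * (- \<i> * of_real (exp (- pi * l)) * osc_transform l x)"
    unfolding integral_mult_right_zero osc_transform_def ..
  also have "\<dots> = of_real (J * exp (- pi * l) / 2) * osc_transform l x"
    by (simp add: mult_ac)
  also have "J * exp (- pi * l) / 2 = pi * (exp (- pi * l) / (2 * cosh (pi * l)))"
    by (simp add: J_def)
  finally show ?thesis .
qed

text \<open>The choice of \<open>l\<close> means \<open>exp (2 * pi * l) = 1 / s - 1\<close>, and
  the left side is \<open>1 / (exp (2 * pi * l) + 1)\<close>. It is this relation that ties the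
  exponent in the symbol to the spectral value.\<close>

lemma exp_over_cosh_eq:
  assumes "0 < s" "s < 1"
  defines "l \<equiv> ln (1 / s - 1) / (2 * pi)"
  shows "exp (- pi * l) / (2 * cosh (pi * l)) = s"
proof -
  have "exp (pi * l) * exp (pi * l) = exp (ln (1 / s - 1))"
    by (simp add: l_def flip: exp_add)
  also have "\<dots> = 1 / s - 1" using assms(1,2) by simp
  finally have E: "exp (pi * l) * exp (pi * l) = 1 / s - 1" .
  have "exp (- pi * l) / (2 * cosh (pi * l)) = 1 / (exp (pi * l) * exp (pi * l) + 1)"
  proof -
    have "2 * cosh (pi * l) = (exp (pi * l) * exp (pi * l) + 1) / exp (pi * l)"
      by (simp add: cosh_field_def exp_minus add_divide_distrib inverse_eq_divide)
    moreover have "exp (- pi * l) = 1 / exp (pi * l)"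
      by (simp add: exp_minus inverse_eq_divide)
    ultimately show ?thesis by simp
  qed
  also have "\<dots> = s" unfolding E by simp
  finally show ?thesis .
qed

theorem mainTheorem3:
  fixes s :: real
  assumes "s \<in> {0<..<1}"
  shows "(\<forall>x>0. set_integrable lborel {0<..} (\<lambda>y. complex_of_real (1 / pi * sinc (x - y)) * q s y)
            \<and> (LBINT y:{0<..}. complex_of_real (1 / pi * sinc (x - y)) * q s y)
                = complex_of_real s * q s x)
         \<and> spectral_function sinc_kernel (complex_of_real s) (q s)"
proof -
  have s: "0 < s" "s < 1" using assms by auto
  define l where "l = ln (1 / s - 1) / (2 * pi)"
  define k where "k = complex_of_real ((2 * pi) powr (- 1/2)) * (- 2 * \<i> * of_real (cosh (pi * l)))"
  have q: "q s y = k * osc_transform l y" if "y > 0" for y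
    using q_eq_osc_transform[OF s that] by (simp only: k_def l_def mult.assoc)
  \<comment> \<open>The representation of \<open>q s\<close> holds for positive arguments; elsewhere
    the indicator makes both sides 0.\<close>
  have kernel: "indicator {0<..} y *\<^sub>R (complex_of_real (1 / pi * sinc (x - y)) * q s y)
      = k / pi * (indicator {0<..} y *\<^sub>R (of_real (sinc (x - y)) * osc_transform l y))" for x y
  proof (cases "y > 0")
    case True
    then show ?thesis unfolding q[OF True] of_real_mult by simp
  qed simp
  have main: "set_integrable lborel {0<..} (\<lambda>y. complex_of_real (1 / pi * sinc (x - y)) * q s y)
      \<and> (LBINT y:{0<..}. complex_of_real (1 / pi * sinc (x - y)) * q s y) = complex_of_real s * q s x"
    if x: "x > 0" for x
  proof
    show "set_integrable lborel {0<..} (\<lambda>y. complex_of_real (1 / pi * sinc (x - y)) * q s y)"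
      unfolding set_integrable_def kernel by (intro integrable_mult_right integrable_sinc_osc_transform x)
    have "(LBINT y:{0<..}. complex_of_real (1 / pi * sinc (x - y)) * q s y) = k / pi * (of_real (pi * s) * osc_transform l x)"
      unfolding set_lebesgue_integral_def kernel integral_mult_right_zero integral_sinc_osc_transform[OF x]
        l_def exp_over_cosh_eq[OF s] ..
    then show "(LBINT y:{0<..}. complex_of_real (1 / pi * sinc (x - y)) * q s y) = complex_of_real s * q s x"
      unfolding q[OF x] by simp
  qed
  then show ?thesis
    unfolding spectral_function_def wiener_hopf_def sinc_kernel_def by simp
qed

end
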